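(* Let $D:f=0$ be a reduced surface of degree $d$ in $\mathbb{P}^3$ over $\mathbb{C}$, not a cone over a plane curve and with one-dimensional singular subscheme, tame with respect to the pair of syzygies $\rho_1,\rho_2$ of degrees $e_1=\deg\rho_1\le e_2=\deg\rho_2$. Set $e_3=d-1-e_1-e_2$ and assume $e_3\ge e_2$. Then $D$ is nearly free with exponents $e_1,e_2,e_3+1$ if and only if $\dim B(f)_1=2$, where $B(f)_1$ is the space of linear forms in the Bourbaki ideal $B(f)\subset S$.
   Context: Let $S=\mathbb{C}[x,y,z,w]$ with the standard grading, $f\in S$ homogeneous of degree $d$, with partial derivatives $f_x,f_y,f_z,f_w$, Jacobian ideal $J_f=(f_x,f_y,f_z,f_w)$ and Milnor algebra $M(f)=S/J_f$ (graded). The singular subscheme of $D:f=0$ is the subscheme of $\mathbb{P}^3$ defined by $J_f$. Syzygies: $AR(f)\subset S^4$ is the graded $S$-module of all $\rho=(\alpha,\beta,\gamma,\delta)$ with $\alpha f_x+\beta f_y+\gamma f_z+\delta f_w=0$; $AR(f)_q$ consists of those with all components in $S_q$, and such a $\rho$ has degree $q$. Choice of $\rho_1,\rho_2$: $\rho_1$ is a nonzero homogeneous element of minimal degree $e_1$ in $AR(f)$, and $\rho_2\in AR(f)$ is a homogeneous representative of a nonzero homogeneous element of minimal degree $e_2\ge e_1$ in $AR(f)/(S\rho_1)$. Forms: $\Omega^k$ is the $S$-module of algebraic differential $k$-forms on $\mathbb{C}^4$; for $\rho=(\alpha,\beta,\gamma,\delta)$ put $\omega(\rho)=\alpha\,dx+\beta\,dy+\gamma\,dz+\delta\,dw$,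 and let $\Omega^1_0=\{\omega(\rho):\rho\in AR(f)\}$. $X=\nabla f=f_x\partial_x+f_y\partial_y+f_z\partial_z+f_w\partial_w$ and $\iota_X$ is contraction with $X$. Tameness: $D$ is tame with respect to $\rho_1,\rho_2$ (where $\rho_1$ is a nonzero element of minimal degree $e_1$ in $AR(f)$ and $\rho_2$ represents a nonzero homogeneous element of minimal degree $e_2$ in $AR(f)/(S\rho_1)$) if the sequence $S(-e_1-1)\oplus S(-e_2-1)\xrightarrow{u}\Omega^1_0\xrightarrow{v}\Omega^3(e_1+e_2+2)$ is exact (at the middle term), where $u(a,b)=a\,\omega(\rho_1)+b\,\omega(\rho_2)$ and $v(\omega)=\omega(\rho_1)\wedge\omega(\rho_2)\wedge\omega$. Bourbaki ideal: for $\rho\in AR(f)$ there is a unique $h\in S$ with $\omega(\rho_1)\wedge\omega(\rho_2)\wedge\omega(\rho)=h\,\iota_X(dx\wedge dy\wedge dz\wedge dw)$; put $v'(\rho)=h$. This gives a graded morphism $v':AR(f)\to S(-e_3)$ (a syzygy of degree $q$ goes to a polynomial of degree $q-e_3$), and $B(f)\subset S$ is the homogeneous ideal which is the image of $v'$, graded as an ideal of $S$, so that $B(f)_1=v'(AR(f)_{e_3+1})\subset S_1$. Near freeness: $D$ is nearly free with exponents $1\le d_1\le d_2\le d_3$ (with $d_4=d_3$) if $M(f)$ has a minimal graded free resolution of the form $$0\to S(-d-d_3)\to\bigoplus_{j=1}^{4}S(-d-d_j+1)\to S^4(-d+1)\xrightarrow{(f_x,f_y,f_z,f_w)}S;$$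 equivalently, $AR(f)$ is minimally generated by four syzygies of degrees $d_1\le d_2\le d_3=d_4=d-(d_1+d_2)$. *)

theory Defs
  imports
    "HOL-Analysis.Analysis"
    "HOL-Library.Poly_Mapping"
    "HOL-Computational_Algebra.Squarefree"
begin

section \<open>The graded polynomial ring in four variables\<close>

text \<open>
  Monomials are exponent vectors indexed by the four-element type \<open>4\<close>; the variables
  $x, y, z, w$ correspond to the indices \<open>0, 1, 2, 3 :: 4\<close>, in this order.
\<close>

type_synonym monomial = "4 \<Rightarrow>\<^sub>0 nat"
type_synonym mpoly4 = "monomial \<Rightarrow>\<^sub>0 complex"

definition const :: "complex \<Rightarrow> mpoly4" where
  "const c = Poly_Mapping.single 0 c"

definition var :: "4 \<Rightarrow> mpoly4" where
  "var i = Poly_Mapping.single (Poly_Mapping.single i 1) 1"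

definition mdeg :: "monomial \<Rightarrow> nat" where
  "mdeg m = (\<Sum>i\<in>UNIV. Poly_Mapping.lookup m i)"

text \<open>The graded piece $S_q$; it contains \<open>0\<close> for every \<open>q\<close>.\<close>

definition forms :: "nat \<Rightarrow> mpoly4 set" where
  "forms q = {p. \<forall>m\<in>Poly_Mapping.keys p. mdeg m = q}"

definition hom_component :: "nat \<Rightarrow> mpoly4 \<Rightarrow> mpoly4" where
  "hom_component q p =
     (\<Sum>m | m \<in> Poly_Mapping.keys p \<and> mdeg m = q. Poly_Mapping.single m (Poly_Mapping.lookup p m))"

text \<open>The ideal $S_+ = (x,y,z,w)$: polynomials without constant term.\<close>

definition irrelevant_ideal :: "mpoly4 set" where
  "irrelevant_ideal = {p. Poly_Mapping.lookup p 0 = 0}"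

definition pderiv4 :: "4 \<Rightarrow> mpoly4 \<Rightarrow> mpoly4" where
  "pderiv4 i p =
     (\<Sum>m\<in>Poly_Mapping.keys p.
        Poly_Mapping.single (m - Poly_Mapping.single i 1)
          (of_nat (Poly_Mapping.lookup m i) * Poly_Mapping.lookup p m))"

definition gradient :: "mpoly4 \<Rightarrow> mpoly4 ^ 4" where
  "gradient f = (\<chi> i. pderiv4 i f)"

global_interpretation cpoly: vector_space "\<lambda>c (p :: mpoly4). const c * p"
  by standard (simp_all add: const_def algebra_simps single_add Poly_Mapping.mult_single
      flip: mult.assoc)

text \<open>The ring as a module over itself: its subspaces are the ideals.\<close>

global_interpretation ideals: module "(*) :: mpoly4 \<Rightarrow> mpoly4 \<Rightarrow> mpoly4"
  by standard (simp_all add: algebra_simps)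

definition jacobian_ideal :: "mpoly4 \<Rightarrow> mpoly4 set" where
  "jacobian_ideal f = ideals.span (range (\<lambda>i. pderiv4 i f))"


section \<open>Surfaces\<close>

definition linear_subst :: "complex ^ 4 ^ 4 \<Rightarrow> mpoly4 \<Rightarrow> mpoly4" where
  "linear_subst A p =
     (\<Sum>m\<in>Poly_Mapping.keys p. const (Poly_Mapping.lookup p m) *
        (\<Prod>i\<in>UNIV. (\<Sum>j\<in>UNIV. const (A $ i $ j) * var j) ^ Poly_Mapping.lookup m i))"

text \<open>
  The surface is a cone over a plane curve iff, in suitable linear coordinates, its equation
  does not involve the last variable (the vertex then being \<open>(0:0:0:1)\<close>).
\<close>

definition is_cone :: "mpoly4 \<Rightarrow> bool" where
  "is_cone f \<longleftrightarrow> (\<exists>A. invertible A \<and>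
     (\<forall>m\<in>Poly_Mapping.keys (linear_subst A f). Poly_Mapping.lookup m 3 = 0))"

definition reduced_surface :: "nat \<Rightarrow> mpoly4 \<Rightarrow> bool" where
  "reduced_surface d f \<longleftrightarrow> d \<ge> 1 \<and> f \<noteq> 0 \<and> f \<in> forms d \<and> squarefree f"

definition homogeneous_prime :: "mpoly4 set \<Rightarrow> bool" where
  "homogeneous_prime P \<longleftrightarrow>
     ideals.subspace P \<and> P \<noteq> UNIV \<and> (\<forall>a b. a * b \<in> P \<longrightarrow> a \<in> P \<or> b \<in> P) \<and>
     (\<forall>p\<in>P. \<forall>q. hom_component q p \<in> P)"

text \<open>
  The points of the subscheme $\mathrm{Proj}(S/I)$ of $\mathbb{P}^3$ are the homogeneous primes
  containing \<open>I\<close> but not $S_+$; chains of irreducible closed subsets are chains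
  of such primes.
\<close>

definition proj_points :: "mpoly4 set \<Rightarrow> mpoly4 set set" where
  "proj_points I = {P. homogeneous_prime P \<and> I \<subseteq> P \<and> \<not> irrelevant_ideal \<subseteq> P}"

definition proj_chain :: "mpoly4 set \<Rightarrow> nat \<Rightarrow> (nat \<Rightarrow> mpoly4 set) \<Rightarrow> bool" where
  "proj_chain I n P \<longleftrightarrow> (\<forall>k\<le>n. P k \<in> proj_points I) \<and> (\<forall>k<n. P k \<subset> P (Suc k))"

definition has_proj_dim :: "mpoly4 set \<Rightarrow> nat \<Rightarrow> bool" where
  "has_proj_dim I n \<longleftrightarrow> (\<exists>P. proj_chain I n P) \<and> (\<nexists>P. proj_chain I (Suc n) P)"


section \<open>Syzygies\<close>

definition AR :: "mpoly4 \<Rightarrow> (mpoly4 ^ 4) set" where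
  "AR f = {\<rho>. (\<Sum>i\<in>UNIV. \<rho> $ i * pderiv4 i f) = 0}"

definition AR_deg :: "mpoly4 \<Rightarrow> nat \<Rightarrow> (mpoly4 ^ 4) set" where
  "AR_deg f q = {\<rho> \<in> AR f. \<forall>i. \<rho> $ i \<in> forms q}"

text \<open>
  A homogeneous element of degree \<open>q\<close> of $AR(f)/(S\rho_1)$ is the class of some
  $\rho\in AR(f)_q$, and it is nonzero iff $\rho\notin S\rho_1$.
\<close>

definition minimal_syzygy_pair ::
    "mpoly4 \<Rightarrow> mpoly4 ^ 4 \<Rightarrow> mpoly4 ^ 4 \<Rightarrow> nat \<Rightarrow> nat \<Rightarrow> bool" where
  "minimal_syzygy_pair f \<rho>1 \<rho>2 e1 e2 \<longleftrightarrow>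
     \<rho>1 \<in> AR_deg f e1 \<and> \<rho>1 \<noteq> 0 \<and> (\<forall>q. \<forall>\<rho>\<in>AR_deg f q. \<rho> \<noteq> 0 \<longrightarrow> e1 \<le> q) \<and>
     \<rho>2 \<in> AR_deg f e2 \<and> \<rho>2 \<notin> range (\<lambda>a. a *s \<rho>1) \<and>
     (\<forall>q. \<forall>\<rho>\<in>AR_deg f q. \<rho> \<notin> range (\<lambda>a. a *s \<rho>1) \<longrightarrow> e2 \<le> q)"


section \<open>Differential forms\<close>

text \<open>
  An element of $\Omega^\bullet = \bigoplus_k \Omega^k$ is given by its coefficients with respect
  to the basis $dx_I$ (increasing products), \<open>I\<close> ranging over the subsets of the index type;
  the $k$-forms are supported on sets of cardinality $k$.
\<close>

type_synonym diff_form = "mpoly4 ^ (4 set)"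

definition basis_form :: "4 set \<Rightarrow> diff_form" where
  "basis_form I = axis I 1"

text \<open>$dx_I\wedge dx_J = (-1)^{s} dx_{I\cup J}$ for disjoint $I, J$, where $s$ counts inversions.\<close>

definition wedge :: "diff_form \<Rightarrow> diff_form \<Rightarrow> diff_form" where
  "wedge \<omega> \<eta> = (\<chi> K. \<Sum>I\<in>Pow K.
     (- 1) ^ card {(i, j). i \<in> I \<and> j \<in> K - I \<and> j < i} * \<omega> $ I * \<eta> $ (K - I))"

text \<open>Contraction with $\sum_i X_i\,\partial_i$.\<close>

definition contract :: "mpoly4 ^ 4 \<Rightarrow> diff_form \<Rightarrow> diff_form" where
  "contract X \<omega> = (\<chi> K. \<Sum>i\<in>- K.
     (- 1) ^ card {j\<in>K. j < i} * X $ i * \<omega> $ insert i K)"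

definition form_of :: "mpoly4 ^ 4 \<Rightarrow> diff_form" where
  "form_of \<rho> = (\<Sum>i\<in>UNIV. \<rho> $ i *s basis_form {i})"

definition Omega1_0 :: "mpoly4 \<Rightarrow> diff_form set" where
  "Omega1_0 f = form_of ` AR f"

definition wedge3 :: "mpoly4 ^ 4 \<Rightarrow> mpoly4 ^ 4 \<Rightarrow> diff_form \<Rightarrow> diff_form" where
  "wedge3 \<rho>1 \<rho>2 \<omega> = wedge (wedge (form_of \<rho>1) (form_of \<rho>2)) \<omega>"

definition tame :: "mpoly4 \<Rightarrow> mpoly4 ^ 4 \<Rightarrow> mpoly4 ^ 4 \<Rightarrow> bool" where
  "tame f \<rho>1 \<rho>2 \<longleftrightarrow>
     {\<omega> \<in> Omega1_0 f. wedge3 \<rho>1 \<rho>2 \<omega> = 0} =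
     range (\<lambda>(a, b). a *s form_of \<rho>1 + b *s form_of \<rho>2)"

definition bourbaki_map :: "mpoly4 \<Rightarrow> mpoly4 ^ 4 \<Rightarrow> mpoly4 ^ 4 \<Rightarrow> mpoly4 ^ 4 \<Rightarrow> mpoly4" where
  "bourbaki_map f \<rho>1 \<rho>2 \<rho> =
     (THE h. wedge3 \<rho>1 \<rho>2 (form_of \<rho>) = h *s contract (gradient f) (basis_form UNIV))"

definition bourbaki_ideal :: "mpoly4 \<Rightarrow> mpoly4 ^ 4 \<Rightarrow> mpoly4 ^ 4 \<Rightarrow> mpoly4 set" where
  "bourbaki_ideal f \<rho>1 \<rho>2 = bourbaki_map f \<rho>1 \<rho>2 ` AR f"


section \<open>Near freeness\<close>

text \<open>
  A degree-preserving homomorphism $\bigoplus_j S(-b_j)\to\bigoplus_i S(-a_i)$ is a matrix whose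
  $(i,j)$ entry lies in $S_{b_j-a_i}$. In a minimal resolution all entries lie in $S_+$.
\<close>

definition minimal_graded_matrix :: "('n \<Rightarrow> int) \<Rightarrow> ('m \<Rightarrow> int) \<Rightarrow> mpoly4 ^ 'n ^ 'm \<Rightarrow> bool" where
  "minimal_graded_matrix b a A \<longleftrightarrow>
     (\<forall>i j. A $ i $ j \<in> irrelevant_ideal \<and>
        (if a i \<le> b j then A $ i $ j \<in> forms (nat (b j - a i)) else A $ i $ j = 0))"

text \<open>
  \<open>G\<close>, \<open>R\<close> and \<open>C\<close> are the maps of the minimal graded free resolution
  \[ 0 \to S(-d-d_3) \xrightarrow{C} \bigoplus_{j=1}^4 S(-d-d_j+1) \xrightarrow{R} S^4(-d+1)
     \xrightarrow{G = (f_x,f_y,f_z,f_w)} S \]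
  of $M(f) = S/J_f$, where $d_4 = d_3$.
\<close>

definition nearly_free :: "nat \<Rightarrow> mpoly4 \<Rightarrow> nat \<Rightarrow> nat \<Rightarrow> nat \<Rightarrow> bool" where
  "nearly_free d f d1 d2 d3 \<longleftrightarrow>
     1 \<le> d1 \<and> d1 \<le> d2 \<and> d2 \<le> d3 \<and>
     (\<exists>(G :: mpoly4 ^ 4 ^ 1) (R :: mpoly4 ^ 4 ^ 4) (C :: mpoly4 ^ 1 ^ 4).
        G = (\<chi> i. gradient f) \<and>
        minimal_graded_matrix (\<lambda>_. int d - 1) (\<lambda>_. 0) G \<and>
        minimal_graded_matrix
          (\<lambda>j. int d + int (if j = 0 then d1 else if j = 1 then d2 else d3) - 1)
          (\<lambda>_. int d - 1) R \<and>
        minimal_graded_matrix (\<lambda>_. int d + int d3)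
          (\<lambda>j. int d + int (if j = 0 then d1 else if j = 1 then d2 else d3) - 1) C \<and>
        range (\<lambda>u. (G *v u) $ 1) = jacobian_ideal f \<and>
        {u. G *v u = 0} = range ((*v) R) \<and>
        {u. R *v u = 0} = range ((*v) C) \<and>
        inj ((*v) C))"

end

theory Submission
  imports Defs "HOL-Computational_Algebra.Polynomial_Factorial" "HOL-Computational_Algebra.Field_as_Ring"
begin

text \<open>
  The partial derivatives of a squarefree form have no common divisor, so the $3$-form
  $\omega(\rho_1)\wedge\omega(\rho_2)\wedge\omega(\rho)$, which $\iota_X$ annihilates, is a multiple of the
  contracted volume form and $v'$ is defined on $AR(f)$; by tameness its kernel is $S\rho_1+S\rho_2$.

  If $AR(f)$ is minimally generated by $r_1,\dots,r_4$ of degrees $e_1,e_2,e_3+1,e_3+1$, then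
  $\rho_1,\rho_2\in Sr_1+Sr_2$ for degree reasons. Hence $v'(r_1)=v'(r_2)=0$, and $B(f)$ is generated by the
  linear forms $v'(r_3),v'(r_4)$. A linear dependence over $\mathbb{C}$ between them would give a relation of
  $r_1,\dots,r_4$ with a unit coefficient.

  Conversely, if $l_1,l_2$ is a basis of $B(f)_1$, then tameness and the primality of $(l_1,l_2)$ force
  $B(f)=(l_1,l_2)$. Preimages of $l_1,l_2$ together with $\rho_1,\rho_2$ generate $AR(f)$, and the only
  relation lifts the Koszul relation of $l_1,l_2$.
\<close>

subsection \<open>Graded polynomials in four variables\<close>

text \<open>The dimension of B(f)_1 says nothing about generators of B(f) in higher degrees. They
  are excluded because \<rho>1 and \<rho>2 are independent over S: combining the kernel elements
  obtained from \<tau>1, \<tau>2 and a further syzygy leaves identities between coefficients alone,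
  to which primality of (l_1,l_2) applies. Up to sign, v'(\<rho>) f_i is a maximal minor of the
  matrix with columns \<rho>1, \<rho>2, \<rho>; comparing its degree with d-1 = deg f_i gives the
  shift e_3 = d-1-e_1-e_2. The inequality e_2 \<le> e_3 puts \<rho>1 and \<rho>2 strictly below the
  degree e_3+1 of r_3 and r_4; these are the degree reasons. The surface not being a cone means that
  no syzygy is constant, hence e_1 \<ge> 1, as near freeness demands. Unique factorization serves
  only to divide a vector proportional to the gradient by the gradient. Primality of ideals of
  linear forms comes instead from explicit substitutions, S being a domain.\<close>

lemma less_4 [simp]: "(0::4) < 1" "(0::4) < 2" "(0::4) < 3" "(1::4) < 2" "(1::4) < 3" "(2::4) < 3"
  by (simp_all add: less_bit0_def bit0.Rep_0 bit0.Rep_1 bit0.Rep_numeral)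

text \<open>In type \<open>4\<close> the numeral 4 equals 0, and 0, the index of x, is the least
  element in the order that fixes the signs of \<open>wedge\<close> and \<open>contract\<close>.
  Hence the enumeration starts at 0.\<close>

lemma UNIV_4_from_0: "(UNIV :: 4 set) = {0, 1, 2, 3}"
proof -
  have "(4 :: 4) = 0" by simp
  moreover have "{a, b, c, e} = {e, a, b, c}" for a b c e :: 4 by blast
  ultimately show ?thesis unfolding UNIV_4 by metis
qed

lemma distinct_4: "(0::4) \<notin> {1, 2, 3}" "(1::4) \<notin> {2, 3}" "(2::4) \<notin> {3}" "(3::4) \<notin> {}"
  by simp_all

lemma prod_UNIV_4: "(\<Prod>i\<in>UNIV. g i) = g (0::4) * (g 1 * (g 2 * g 3))" for g :: "4 \<Rightarrow> 'a :: comm_monoid_mult"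
  unfolding UNIV_4_from_0
  by (simp only: prod.insert distinct_4 finite.intros not_False_eq_True prod.empty mult_1_right)

lemma sum_UNIV_4: "(\<Sum>i\<in>UNIV. g i) = g (0::4) + (g 1 + (g 2 + g 3))" for g :: "4 \<Rightarrow> 'a :: comm_monoid_add"
  unfolding UNIV_4_from_0
  by (simp only: sum.insert distinct_4 finite.intros not_False_eq_True sum.empty add_0_right)

lemma all_4_from_0: "(\<forall>i::4. Q i) \<longleftrightarrow> Q 0 \<and> Q 1 \<and> Q 2 \<and> Q 3"
  using UNIV_4_from_0 by (metis UNIV_I insertE singletonD)

lemma poly_mapping_induct_single_add [case_names single add]:
  fixes p :: "'a \<Rightarrow>\<^sub>0 'b::comm_monoid_add"
  assumes single: "\<And>m c. P (Poly_Mapping.single m c)"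
    and add: "\<And>p q. P p \<Longrightarrow> P q \<Longrightarrow> P (p + q)"
  shows "P p"
proof -
  have exp: "p = (\<Sum>m\<in>Poly_Mapping.keys p. Poly_Mapping.single m (Poly_Mapping.lookup p m))"
    by (rule poly_mapping_eqI)
      (auto simp: lookup_sum lookup_single when_def in_keys_iff)
  have "P (\<Sum>m\<in>A. Poly_Mapping.single m (Poly_Mapping.lookup p m))" if "finite A" for A
    using that
  proof induction
    case empty
    then show ?case using single[of undefined 0] by simp
  next
    case (insert m A)
    then show ?case using single add by simp
  qed
  then show ?thesis using exp by (metis finite_keys)
qed

lemma mdeg_add: "mdeg (m + n) = mdeg m + mdeg n"
  by (simp add: mdeg_def lookup_add sum.distrib)

text \<open>The homomorphism of the universal property of S. It is used with three targets:
  polynomials in t over S, iterated univariate polynomials, and S itself for substitutions.\<close>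

definition poly_eval :: "(complex \<Rightarrow> 'a::comm_ring_1) \<Rightarrow> (4 \<Rightarrow> 'a) \<Rightarrow> mpoly4 \<Rightarrow> 'a" where
  "poly_eval h y p =
     (\<Sum>m\<in>Poly_Mapping.keys p. h (Poly_Mapping.lookup p m) * (\<Prod>i\<in>UNIV. y i ^ Poly_Mapping.lookup m i))"

lemma single_eq_const_prod_var:
  "Poly_Mapping.single m c = const c * (\<Prod>i\<in>UNIV. var i ^ Poly_Mapping.lookup m i)"
proof -
  have pw: "var i ^ n = Poly_Mapping.single (Poly_Mapping.single i n) 1" for i n
    by (induction n) (auto simp: var_def mult_single single_add[symmetric])
  have "(\<Prod>i\<in>A. var i ^ Poly_Mapping.lookup m i) =
      Poly_Mapping.single (\<Sum>i\<in>A. Poly_Mapping.single i (Poly_Mapping.lookup m i)) 1"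
    if "finite A" for A
    using that by induction (auto simp: pw mult_single)
  moreover have "(\<Sum>i\<in>UNIV. Poly_Mapping.single i (Poly_Mapping.lookup m i)) = m"
    by (rule poly_mapping_eqI) (simp add: lookup_sum lookup_single when_def)
  ultimately show ?thesis by (simp add: const_def mult_single)
qed

text \<open>Suited to properties compatible with products, such as the chain rule and congruence
  modulo an ideal.\<close>

lemma mpoly4_induct [case_names const var add mult]:
  assumes const: "\<And>c. P (const c)" and var: "\<And>i. P (var i)"
    and add: "\<And>p q. P p \<Longrightarrow> P q \<Longrightarrow> P (p + q)" and mult: "\<And>p q. P p \<Longrightarrow> P q \<Longrightarrow> P (p * q)"
  shows "P p"
proof (induction p rule: poly_mapping_induct_single_add)
  case (single m c)
  have one: "P 1" using const[of 1] by (simp add: const_def)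
  have pw: "P (var i ^ n)" for i n
    by (induction n) (auto intro: one var mult)
  have "P (\<Prod>i\<in>A. var i ^ Poly_Mapping.lookup m i)" if "finite A" for A
    using that by induction (auto intro: one pw mult)
  then show ?case unfolding single_eq_const_prod_var by (intro mult const) simp
qed (rule add)

locale coeff_hom =
  fixes h :: "complex \<Rightarrow> 'a::comm_ring_1"
  assumes hom_add: "h (a + b) = h a + h b"
    and hom_mult: "h (a * b) = h a * h b"
    and hom_one: "h 1 = 1"
begin

lemma hom_zero: "h 0 = 0"
  using hom_add[of 0 0] by simp

lemma poly_eval_single:
  "poly_eval h y (Poly_Mapping.single m c) = h c * (\<Prod>i\<in>UNIV. y i ^ Poly_Mapping.lookup m i)"
  by (cases "c = 0") (auto simp: poly_eval_def hom_zero)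

lemma poly_eval_add: "poly_eval h y (p + q) = poly_eval h y p + poly_eval h y q"
  unfolding poly_eval_def
  \<comment> \<open>Cancellation may shrink the support of \<open>p + q\<close>; the lost keys would
    contribute \<open>h 0 = 0\<close>.\<close>
  by (rule setsum_keys_plus_distrib) (simp_all add: hom_zero hom_add algebra_simps)

lemma poly_eval_sum: "poly_eval h y (\<Sum>i\<in>A. g i) = (\<Sum>i\<in>A. poly_eval h y (g i))"
proof (induction A rule: infinite_finite_induct)
  case (insert i A)
  then show ?case by (simp add: poly_eval_add)
qed (simp_all add: poly_eval_def)

lemma poly_eval_mult: "poly_eval h y (p * q) = poly_eval h y p * poly_eval h y q"
proof (induction p rule: poly_mapping_induct_single_add)
  case (single m c)
  show ?case
  proof (induction q rule: poly_mapping_induct_single_add)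
    case (single n d)
    show ?case
      by (simp add: mult_single poly_eval_single hom_mult lookup_add power_add prod.distrib algebra_simps)
  next
    case (add p q)
    then show ?case by (simp add: poly_eval_add algebra_simps)
  qed
next
  case (add p q)
  then show ?case by (simp add: poly_eval_add algebra_simps)
qed

lemma poly_eval_const: "poly_eval h y (const c) = h c"
  by (simp add: const_def poly_eval_single)

lemma poly_eval_var: "poly_eval h y (var i) = y i"
proof -
  have "(\<Prod>j\<in>UNIV. y j ^ Poly_Mapping.lookup (Poly_Mapping.single i 1) j) = (\<Prod>j\<in>UNIV. if j = i then y i else 1)"
    by (rule prod.cong) (auto simp: lookup_single when_def)
  then show ?thesis by (simp add: var_def poly_eval_single hom_one)
qed

end

section \<open>Homogeneous components and forms\<close>

lemma in_forms_iff: "p \<in> forms q \<longleftrightarrow> (\<forall>m. Poly_Mapping.lookup p m \<noteq> 0 \<longrightarrow> mdeg m = q)"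
  by (auto simp: forms_def in_keys_iff)

lemma lookup_hom_component:
  "Poly_Mapping.lookup (hom_component q p) m = (if mdeg m = q then Poly_Mapping.lookup p m else 0)"
  by (auto simp: hom_component_def lookup_sum lookup_single when_def in_keys_iff)

lemma hom_component_zero [simp]: "hom_component q 0 = 0"
  and hom_component_add: "hom_component q (p + r) = hom_component q p + hom_component q r"
  and hom_component_diff: "hom_component q (p - r) = hom_component q p - hom_component q r"
  by (rule poly_mapping_eqI, simp add: lookup_hom_component lookup_add lookup_minus)+

lemma hom_component_sum: "hom_component q (\<Sum>i\<in>A. g i) = (\<Sum>i\<in>A. hom_component q (g i))"
  by (induction A rule: infinite_finite_induct) (simp_all add: hom_component_add)

lemma hom_component_in_forms [simp]: "hom_component q p \<in> forms q"
  by (simp add: in_forms_iff lookup_hom_component)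

lemma hom_component_form: "p \<in> forms q \<Longrightarrow> hom_component r p = (if r = q then p else 0)"
  by (auto intro!: poly_mapping_eqI simp: lookup_hom_component in_forms_iff)

lemma forms_iff_hom_component: "p \<in> forms q \<longleftrightarrow> hom_component q p = p"
  by (metis hom_component_form hom_component_in_forms)

lemma eq_zero_if_hom_components_zero: "(\<And>q. hom_component q p = 0) \<Longrightarrow> p = 0"
  by (rule poly_mapping_eqI) (metis lookup_hom_component lookup_zero)

lemma forms_zero [simp]: "0 \<in> forms q"
  and forms_add: "p \<in> forms q \<Longrightarrow> r \<in> forms q \<Longrightarrow> p + r \<in> forms q"
  and forms_diff: "p \<in> forms q \<Longrightarrow> r \<in> forms q \<Longrightarrow> p - r \<in> forms q"
  and forms_uminus: "p \<in> forms q \<Longrightarrow> - p \<in> forms q"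
  by (auto simp: in_forms_iff lookup_add lookup_minus) (metis add.right_neutral, metis diff_0_right)

lemma forms_sum: "(\<And>i. i \<in> A \<Longrightarrow> g i \<in> forms q) \<Longrightarrow> (\<Sum>i\<in>A. g i) \<in> forms q"
  by (induction A rule: infinite_finite_induct) (simp_all add: forms_add)

lemma single_in_forms: "Poly_Mapping.single m c \<in> forms (mdeg m)"
  by (simp add: in_forms_iff lookup_single when_def)

lemma forms_mult:
  assumes "p \<in> forms a" "r \<in> forms b"
  shows "p * r \<in> forms (a + b)"
proof -
  have "mdeg k = a + b" if "k \<in> Poly_Mapping.keys (p * r)" for k
    using subsetD[OF keys_mult that] assms by (auto simp: forms_def mdeg_add)
  then show ?thesis by (simp add: forms_def)
qed

lemma mdeg_zero [simp]: "mdeg 0 = 0"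
  by (simp add: mdeg_def)

lemma mdeg_eq_0_iff: "mdeg m = 0 \<longleftrightarrow> m = 0"
  by (auto simp: mdeg_def intro: poly_mapping_eqI)

lemma mdeg_single [simp]: "mdeg (Poly_Mapping.single i n) = n"
  by (simp add: mdeg_def lookup_single when_def)

lemma const_in_forms [simp]: "const c \<in> forms 0"
  using single_in_forms[of 0 c] by (simp add: const_def)

lemma var_in_forms [simp]: "var i \<in> forms 1"
  using single_in_forms[of "Poly_Mapping.single i 1" 1] by (simp add: var_def)

lemma forms_0_const: "p \<in> forms 0 \<Longrightarrow> p = const (Poly_Mapping.lookup p 0)"
  by (rule poly_mapping_eqI) (auto simp: const_def lookup_single when_def in_forms_iff mdeg_eq_0_iff)

text \<open>Multiplication by a form of degree \<open>b\<close> shifts the grading by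
  \<open>b\<close>; additivity reduces this to a monomial \<open>p\<close>. The case
  \<open>b \<le> q\<close> is separated because \<open>q - b\<close> is truncated.\<close>

lemma hom_component_mult_form:
  assumes g: "g \<in> forms b"
  shows "hom_component q (p * g) = (if b \<le> q then hom_component (q - b) p * g else 0)"
proof (induction p rule: poly_mapping_induct_single_add)
  case (single m c)
  have "Poly_Mapping.single m c * g \<in> forms (mdeg m + b)"
    by (intro forms_mult single_in_forms g)
  then show ?case
    using hom_component_form[OF single_in_forms] by (auto simp: hom_component_form)
next
  case (add p r)
  then show ?case by (simp add: hom_component_add algebra_simps)
qed

text \<open>\<open>p\<close> and its component of degree \<open>a\<close> have the same product with
  \<open>g\<close>, and \<open>g\<close> cancels.\<close>

lemma form_divide:
  assumes "p * g \<in> forms (a + b)" "g \<in> forms b" "g \<noteq> 0"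
  shows "p \<in> forms a"
proof -
  have "hom_component a p * g = p * g"
    using hom_component_mult_form[OF assms(2), of "a + b" p] assms(1)
    by (simp add: forms_iff_hom_component)
  then show ?thesis using assms(3) by (simp add: forms_iff_hom_component)
qed

lemma const_simps [simp]: "const 0 = 0" "const 1 = 1"
  by (simp_all add: const_def)

lemma const_add: "const (a + b) = const a + const b"
  and const_mult: "const (a * b) = const a * const b"
  and const_uminus: "const (- a) = - const a"
  and const_diff: "const (a - b) = const a - const b"
  by (simp_all add: const_def single_add mult_single single_uminus single_diff)

lemma const_of_nat: "const (of_nat n) = of_nat n"
  by (simp add: const_def)

lemma const_eq_iff [simp]: "const a = const b \<longleftrightarrow> a = b"
  unfolding const_def by (metis lookup_single_eq)

lemma const_eq_0_iff [simp]: "const a = 0 \<longleftrightarrow> a = 0"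
  using const_eq_iff[of a 0] by simp

lemma lookup_const_mult: "Poly_Mapping.lookup (const c * p) m = c * Poly_Mapping.lookup p m"
  by (induction p rule: poly_mapping_induct_single_add)
    (auto simp: const_def mult_single lookup_single when_def lookup_add algebra_simps)

lemma forms_const_mult: "p \<in> forms q \<Longrightarrow> const c * p \<in> forms q"
  by (simp add: in_forms_iff lookup_const_mult)

lemma const_dvd_one: "c \<noteq> 0 \<Longrightarrow> const c dvd 1"
  by (rule dvdI[of _ _ "const (1 / c)"]) (simp flip: const_mult)

section \<open>Partial derivatives and Euler's identity\<close>

lemma lookup_pderiv4:
  "Poly_Mapping.lookup (pderiv4 i p) m =
     of_nat (Poly_Mapping.lookup m i + 1) * Poly_Mapping.lookup p (m + Poly_Mapping.single i 1)"
proof -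
  let ?e = "Poly_Mapping.single i (1::nat)"
  \<comment> \<open>Truncated subtraction gives \<open>n - ?e = n\<close> when the exponent of
    \<open>i\<close> is 0. Such an \<open>n\<close> may hit \<open>m\<close> as well, but its term
    carries the factor 0.\<close>
  have eq: "n - ?e = m \<and> Poly_Mapping.lookup n i \<noteq> 0 \<longleftrightarrow> n = m + ?e" for n
  proof
    assume n: "n - ?e = m \<and> Poly_Mapping.lookup n i \<noteq> 0"
    show "n = m + ?e"
      using n by (auto intro!: poly_mapping_eqI simp: lookup_add lookup_single lookup_minus when_def)
  next
    assume n: "n = m + ?e"
    have "n - ?e = m"
      by (rule poly_mapping_eqI) (simp add: n lookup_add lookup_minus)
    then show "n - ?e = m \<and> Poly_Mapping.lookup n i \<noteq> 0"
      using n by (simp add: lookup_add)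
  qed
  have "Poly_Mapping.lookup (pderiv4 i p) m =
    (\<Sum>n\<in>Poly_Mapping.keys p. of_nat (Poly_Mapping.lookup n i) * Poly_Mapping.lookup p n when n - ?e = m)"
    by (simp add: pderiv4_def lookup_sum lookup_single)
  also have "\<dots> = (\<Sum>n\<in>Poly_Mapping.keys p.
      if n = m + ?e then of_nat (Poly_Mapping.lookup n i) * Poly_Mapping.lookup p n else 0)"
  proof (rule sum.cong[OF refl])
    fix n
    show "(of_nat (Poly_Mapping.lookup n i) * Poly_Mapping.lookup p n when n - ?e = m) =
        (if n = m + ?e then of_nat (Poly_Mapping.lookup n i) * Poly_Mapping.lookup p n else 0)"
    proof (cases "n = m + ?e")
      case True
      then show ?thesis using eq[of n] by (metis "when"(1))
    next
      case False
      then have "n - ?e \<noteq> m \<or> Poly_Mapping.lookup n i = 0" using eq[of n] by metis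
      then show ?thesis using False by (auto simp only: when_def of_nat_0 mult_zero_left split: if_split)
    qed
  qed
  also have "\<dots> = of_nat (Poly_Mapping.lookup m i + 1) * Poly_Mapping.lookup p (m + ?e)"
    by (simp add: sum.delta in_keys_iff lookup_add)
  finally show ?thesis .
qed

lemma pderiv4_zero [simp]: "pderiv4 i 0 = 0"
  and pderiv4_add: "pderiv4 i (p + q) = pderiv4 i p + pderiv4 i q"
  by (rule poly_mapping_eqI, simp add: lookup_pderiv4 lookup_add algebra_simps)+

lemma pderiv4_single:
  "pderiv4 i (Poly_Mapping.single m c) =
     Poly_Mapping.single (m - Poly_Mapping.single i 1) (of_nat (Poly_Mapping.lookup m i) * c)"
  by (cases "c = 0") (simp_all add: pderiv4_def)

lemma pderiv4_mult: "pderiv4 i (p * q) = pderiv4 i p * q + p * pderiv4 i q"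
proof (induction p rule: poly_mapping_induct_single_add)
  case (single m c)
  show ?case
  proof (induction q rule: poly_mapping_induct_single_add)
    case (single n d)
    let ?e = "Poly_Mapping.single i (1::nat)"
    have 1: "m - ?e + n = m + n - ?e" if "Poly_Mapping.lookup m i \<noteq> 0"
      by (rule poly_mapping_eqI) (use that in \<open>auto simp: lookup_add lookup_single lookup_minus when_def\<close>)
    have 2: "m + (n - ?e) = m + n - ?e" if "Poly_Mapping.lookup n i \<noteq> 0"
      by (rule poly_mapping_eqI) (use that in \<open>auto simp: lookup_add lookup_single lookup_minus when_def\<close>)
    show ?case
      using 1 2
      by (cases "Poly_Mapping.lookup m i = 0"; cases "Poly_Mapping.lookup n i = 0")
        (simp_all add: mult_single pderiv4_single lookup_add algebra_simps flip: single_add)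
  next
    case (add p q)
    then show ?case by (simp add: pderiv4_add algebra_simps)
  qed
next
  case (add p q)
  then show ?case by (simp add: pderiv4_add algebra_simps)
qed

lemma pderiv4_const [simp]: "pderiv4 i (const c) = 0"
  by (simp add: const_def pderiv4_single)

lemma pderiv4_var: "pderiv4 i (var j) = (if i = j then 1 else 0)"
  by (simp add: var_def pderiv4_single lookup_single when_def)

lemma pderiv4_sum: "pderiv4 i (\<Sum>j\<in>A. g j) = (\<Sum>j\<in>A. pderiv4 i (g j))"
  by (induction A rule: infinite_finite_induct) (simp_all add: pderiv4_add)

lemma hom_component_pderiv4: "hom_component q (pderiv4 i p) = pderiv4 i (hom_component (Suc q) p)"
  by (rule poly_mapping_eqI) (simp add: lookup_hom_component lookup_pderiv4 mdeg_add)

lemma pderiv4_in_forms: "p \<in> forms (Suc q) \<Longrightarrow> pderiv4 i p \<in> forms q"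
  by (simp add: forms_iff_hom_component hom_component_pderiv4)

text \<open>Characteristic zero: if x_i occurs in a monomial of \<open>p\<close>, differentiation in
  x_i multiplies its coefficient by a positive integer.\<close>

lemma pderiv4_all_zero:
  assumes "\<And>i. pderiv4 i p = 0"
  shows "p \<in> forms 0"
  unfolding in_forms_iff
proof (intro allI impI, rule ccontr)
  fix m assume nz: "Poly_Mapping.lookup p m \<noteq> 0" and "mdeg m \<noteq> 0"
  then obtain i where i: "Poly_Mapping.lookup m i \<noteq> 0"
    by (auto simp: mdeg_def)
  have "m = (m - Poly_Mapping.single i 1) + Poly_Mapping.single i 1"
    by (rule poly_mapping_eqI) (use i in \<open>auto simp: lookup_add lookup_single lookup_minus when_def\<close>)
  then show False
    using lookup_pderiv4[of i p "m - Poly_Mapping.single i 1"] nz assms[of i] i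
    by (simp add: lookup_minus del: of_nat_Suc)
qed

lemma exists_pderiv4_nonzero:
  assumes "p \<in> forms d" "d \<ge> 1" "p \<noteq> 0"
  obtains i where "pderiv4 i p \<noteq> 0"
proof (rule ccontr)
  assume "\<not> thesis"
  then have "p \<in> forms 0" using that by (intro pderiv4_all_zero) blast
  then show False
    using assms hom_component_form[of p 0 d] hom_component_form[of p d d] by simp
qed

lemma euler_identity:
  assumes "p \<in> forms d"
  shows "(\<Sum>i\<in>UNIV. var i * pderiv4 i p) = of_nat d * p"
proof -
  have E: "(\<Sum>i\<in>UNIV. var i * pderiv4 i (Poly_Mapping.single m c)) = of_nat (mdeg m) * Poly_Mapping.single m c"
    for m c
  proof -
    have "var i * pderiv4 i (Poly_Mapping.single m c) = of_nat (Poly_Mapping.lookup m i) * Poly_Mapping.single m c"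
      for i
    proof (cases "Poly_Mapping.lookup m i = 0")
      case False
      have "Poly_Mapping.single i 1 + (m - Poly_Mapping.single i 1) = m"
        by (rule poly_mapping_eqI)
          (use False in \<open>auto simp: lookup_add lookup_single lookup_minus when_def\<close>)
      then show ?thesis
        by (simp add: var_def pderiv4_single mult_single flip: single_of_nat)
    qed (simp add: pderiv4_single)
    then show ?thesis by (simp add: mdeg_def sum_distrib_right)
  qed
  define T where "T r = (\<Sum>i\<in>UNIV. var i * pderiv4 i r)" for r
  have T_add: "T (r + s) = T r + T s" for r s
    by (simp add: T_def pderiv4_add algebra_simps sum.distrib)
  \<comment> \<open>Stated for arbitrary \<open>r\<close>, because the induction over monomials
    passes through inhomogeneous polynomials; in degree \<open>d\<close> the factor
    \<open>mdeg m\<close> becomes \<open>d\<close>.\<close>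
  have "hom_component d (T r) = of_nat d * hom_component d r" for r
  proof (induction r rule: poly_mapping_induct_single_add)
    case (single m c)
    have "T (Poly_Mapping.single m c) = const (of_nat (mdeg m)) * Poly_Mapping.single m c"
      using E by (simp add: T_def const_of_nat)
    moreover have "\<dots> \<in> forms (mdeg m)"
      by (intro forms_const_mult single_in_forms)
    ultimately show ?case
      using hom_component_form[OF single_in_forms[of m c], of d] by (auto simp: hom_component_form const_of_nat)
  next
    case (add p q)
    then show ?case by (simp add: T_add hom_component_add algebra_simps)
  qed
  moreover have "T p \<in> forms d"
  proof (cases d)
    case 0
    then have "pderiv4 i p = 0" for i using forms_0_const assms by (metis pderiv4_const)
    then show ?thesis by (simp add: T_def)
  next
    case (Suc q)
    show ?thesis unfolding T_def
      by (rule forms_sum) (use assms Suc pderiv4_in_forms forms_mult[OF var_in_forms] in force)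
  qed
  ultimately show ?thesis
    using assms by (metis forms_iff_hom_component T_def)
qed

subsection \<open>Total degree\<close>

text \<open>
  Substituting $x_i t$ for $x_i$ turns the total degree into the degree in $t$, which is additive on products.
\<close>

definition grading :: "mpoly4 \<Rightarrow> mpoly4 poly" where
  "grading = poly_eval (\<lambda>c. [:const c:]) (\<lambda>i. [:0, var i:])"

interpretation grading: coeff_hom "\<lambda>c. [:const c:]"
  by standard (simp_all add: const_add const_mult flip: one_pCons)

lemma prod_monom: "finite A \<Longrightarrow> (\<Prod>i\<in>A. monom (g i) (n i)) = monom (\<Prod>i\<in>A. g i) (\<Sum>i\<in>A. n i)"
  by (induction A rule: finite_induct) (simp_all add: mult_monom)

lemma pCons_0_power: "[:0, x:] ^ n = monom (x ^ n) n"
  using monom_power[of x 1 n] by (simp add: monom_Suc monom_0)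

lemma grading_single: "grading (Poly_Mapping.single m c) = monom (Poly_Mapping.single m c) (mdeg m)"
proof -
  have "grading (Poly_Mapping.single m c) =
      [:const c:] * monom (\<Prod>i\<in>UNIV. var i ^ Poly_Mapping.lookup m i) (mdeg m)"
    by (simp only: grading_def grading.poly_eval_single pCons_0_power prod_monom finite mdeg_def)
  also have "\<dots> = monom (Poly_Mapping.single m c) (mdeg m)"
    by (subst single_eq_const_prod_var) (simp only: mult_pCons_left smult_monom mult_zero_left pCons_0_0 add_0_right)
  finally show ?thesis .
qed

lemma coeff_grading: "coeff (grading p) q = hom_component q p"
proof (induction p rule: poly_mapping_induct_single_add)
  case (single m c)
  then show ?case
    using hom_component_form[OF single_in_forms[of m c], of q] by (simp add: grading_single)
next
  case (add p q)
  then show ?case by (simp add: grading_def grading.poly_eval_add hom_component_add)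
qed

lemma grading_eq_0_iff: "grading p = 0 \<longleftrightarrow> p = 0"
  by (metis coeff_0 coeff_grading eq_zero_if_hom_components_zero hom_component_zero poly_eqI)

text \<open>A nonzero multiple of \<open>p\<close> has at least the total degree of
  \<open>p\<close>, but a derivative has less: the top component of the derivative, in degree
  \<open>?n\<close>, comes from the component of \<open>p\<close> in degree \<open>?n + 1\<close>,
  which would vanish.\<close>

lemma dvd_pderiv4_imp_zero:
  assumes "p dvd pderiv4 i p"
  shows "pderiv4 i p = 0"
proof (rule ccontr)
  assume nz: "pderiv4 i p \<noteq> 0"
  obtain r where r: "pderiv4 i p = p * r" using assms by (elim dvdE)
  let ?n = "degree (grading (pderiv4 i p))"
  have "grading (pderiv4 i p) = grading p * grading r"
    by (simp add: r grading_def grading.poly_eval_mult)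
  then have "degree (grading p) \<le> ?n"
    using nz r by (simp add: degree_mult_eq grading_eq_0_iff)
  then have "hom_component (Suc ?n) p = 0"
    by (simp add: coeff_eq_0 flip: coeff_grading)
  then have "coeff (grading (pderiv4 i p)) ?n = 0"
    by (simp add: coeff_grading hom_component_pderiv4)
  then show False using nz by (simp add: grading_eq_0_iff)
qed

subsection \<open>Common divisors\<close>

text \<open>
  The isomorphism with an iterated univariate polynomial ring transports unique factorization.
\<close>

definition nested_var :: "4 \<Rightarrow> complex poly poly poly poly" where
  "nested_var i = (if i = 0 then [:[:[:[:0, 1:]:]:]:] else if i = 1 then [:[:[:0, 1:]:]:]
     else if i = 2 then [:[:0, 1:]:] else [:0, 1:])"

definition nested :: "mpoly4 \<Rightarrow> complex poly poly poly poly" where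
  "nested = poly_eval (\<lambda>c. [:[:[:[:c:]:]:]:]) nested_var"

interpretation nested: coeff_hom "\<lambda>c. [:[:[:[:c:]:]:]:]"
  by standard (simp_all add: one_pCons)

lemma pCons_const_power: "[:x:] ^ n = [:x ^ n:]" for x :: "'a::comm_semiring_1"
  by (induction n) (simp_all add: one_pCons mult.commute)

lemma coeff_nested_single:
  "coeff (coeff (coeff (coeff (nested (Poly_Mapping.single m c)) (n 3)) (n 2)) (n 1)) (n 0) =
     (if \<forall>i. n i = Poly_Mapping.lookup m i then c else 0)"
proof -
  have X: "[:0, 1:] ^ k = monom (1 :: 'a :: comm_ring_1) k" for k
    using pCons_0_power[of 1 k] by simp
  have mult: "[:p:] * q = smult p q" for p :: "'a :: comm_ring_1" and q
    by simp
  have var: "nested_var 0 = [:[:[:[:0, 1:]:]:]:]" "nested_var 1 = [:[:[:0, 1:]:]:]"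
      "nested_var 2 = [:[:0, 1:]:]" "nested_var 3 = [:0, 1:]"
    by (simp_all add: nested_var_def)
  have "nested (Poly_Mapping.single m c) = monom (monom (monom (monom c
     (Poly_Mapping.lookup m 0)) (Poly_Mapping.lookup m 1)) (Poly_Mapping.lookup m 2)) (Poly_Mapping.lookup m 3)"
    by (simp only: nested_def nested.poly_eval_single prod_UNIV_4 var pCons_const_power X mult
        smult_monom mult_1_right)
  then show ?thesis
    by (simp only: coeff_monom all_4_from_0) (simp split: if_split)
qed

text \<open>Coefficients are read from the outermost variable w (index 3) inwards, so all of
  \<open>p\<close> can be recovered from \<open>nested p\<close>; injectivity follows.\<close>

lemma coeff_nested:
  "coeff (coeff (coeff (coeff (nested p) (Poly_Mapping.lookup k 3)) (Poly_Mapping.lookup k 2))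
     (Poly_Mapping.lookup k 1)) (Poly_Mapping.lookup k 0) = Poly_Mapping.lookup p k"
proof (induction p rule: poly_mapping_induct_single_add)
  case (single m c)
  have "(\<forall>i. Poly_Mapping.lookup k i = Poly_Mapping.lookup m i) \<longleftrightarrow> m = k"
    by (metis poly_mapping_eqI)
  then show ?case
    unfolding coeff_nested_single[of m c "Poly_Mapping.lookup k"] by (simp only: lookup_single when_def)
next
  case (add p q)
  then show ?case by (simp add: nested_def nested.poly_eval_add lookup_add)
qed

lemma nested_mult: "nested (p * q) = nested p * nested q"
  and nested_add: "nested (p + q) = nested p + nested q"
  and nested_const: "nested (const c) = [:[:[:[:c:]:]:]:]"
  and nested_var: "nested (var i) = nested_var i"
  by (simp_all add: nested_def nested.poly_eval_mult nested.poly_eval_add nested.poly_eval_const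
      nested.poly_eval_var)

lemma inj_nested: "inj nested"
proof (rule injI)
  fix p q assume "nested p = nested q"
  then show "p = q" by (intro poly_mapping_eqI) (metis coeff_nested)
qed

text \<open>The range is a subring containing the constants and the four variables. As
  \<open>pCons a p\<close> is a constant plus the variable times \<open>p\<close>, each layer of the
  tower is reached from the one below.\<close>

lemma surj_nested: "surj nested"
proof -
  define R where "R = range nested"
  have add: "a + b \<in> R" if "a \<in> R" "b \<in> R" for a b
    using that unfolding R_def by (auto simp flip: nested_add)
  have mult: "a * b \<in> R" if "a \<in> R" "b \<in> R" for a b
    using that unfolding R_def by (auto simp flip: nested_mult)
  have c: "[:[:[:[:c:]:]:]:] \<in> R" for c
    unfolding R_def by (metis nested_const rangeI)
  have v: "nested_var i \<in> R" for i
    unfolding R_def by (metis nested_var rangeI)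
  note v = v[of 0] v[of 1] v[of 2] v[of 3]
  have zero: "0 \<in> R" using c[of 0] by simp
  have 1: "[:[:[:p:]:]:] \<in> R" for p
  proof (induction p)
    case (pCons a p)
    then show ?case using add[OF c[of a] mult[OF v(1) pCons(2)]] by (simp add: nested_var_def)
  qed (use zero in simp)
  have 2: "[:[:p:]:] \<in> R" for p
  proof (induction p)
    case (pCons a p)
    then show ?case using add[OF 1[of a] mult[OF v(2) pCons(2)]] by (simp add: nested_var_def)
  qed (use zero in simp)
  have 3: "[:p:] \<in> R" for p
  proof (induction p)
    case (pCons a p)
    then show ?case using add[OF 2[of a] mult[OF v(3) pCons(2)]] by (simp add: nested_var_def)
  qed (use zero in simp)
  have "p \<in> R" for p
  proof (induction p)
    case (pCons a p)
    then show ?case using add[OF 3[of a] mult[OF v(4) pCons(2)]] by (simp add: nested_var_def)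
  qed (use zero in simp)
  then show ?thesis unfolding R_def by blast
qed

lemma nested_dvd_iff: "nested p dvd nested q \<longleftrightarrow> p dvd q"
proof
  assume "nested p dvd nested q"
  then obtain r where "nested q = nested p * nested r"
    using surj_nested by (metis dvdE surj_def)
  then have "q = p * r" using inj_nested by (metis injD nested_mult)
  then show "p dvd q" by simp
qed (auto simp: nested_mult elim!: dvdE)

lemma nested_zero [simp]: "nested 0 = 0"
  using nested_const[of 0] by simp

lemma nested_one [simp]: "nested 1 = 1"
  using nested_const[of 1] by (simp add: one_pCons)

text \<open>
  By Euler's identity a common prime divisor $g$ of the $f_i$ divides $f=gh$. Then $g$ divides $g_ih$ for all
  $i$, hence $g\mid h$, as not all $g_i$ vanish, and $g^2$ divides $f$.
\<close>

lemma squarefree_gradient_coprime: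
  assumes f: "f \<in> forms d" "d \<ge> 1" "f \<noteq> 0" and sqf: "squarefree f"
    and u: "\<And>i. u dvd nested (pderiv4 i f)"
  shows "is_unit u"
proof (rule ccontr)
  assume "\<not> is_unit u"
  moreover have "u \<noteq> 0"
  proof
    assume "u = 0"
    then have "pderiv4 i f = 0" for i
      using u[of i] inj_nested nested_zero by (metis dvd_0_left injD)
    then show False using exists_pderiv4_nonzero[OF f] by metis
  qed
  ultimately obtain p where p: "p dvd u" "prime p"
    using prime_divisor_exists by blast
  obtain g where g: "p = nested g" using surj_nested by (metis surjD)
  have g_prime: "g dvd a \<or> g dvd b" if "g dvd a * b" for a b
    using that p(2) unfolding g by (metis nested_dvd_iff nested_mult prime_dvd_mult_iff)
  have g_dvd: "g dvd pderiv4 i f" for i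
    using dvd_trans[OF p(1) u] by (simp add: g nested_dvd_iff)
  have nu: "\<not> g dvd 1"
    using p(2) nested_dvd_iff[of g 1] g by (auto simp: prime_def)
  have g0: "g \<noteq> 0"
    using p(2) g by auto
  have "g dvd (\<Sum>i\<in>UNIV. var i * pderiv4 i f)"
    by (intro dvd_sum dvd_mult g_dvd)
  \<comment> \<open>The factor \<open>d\<close> in Euler's identity is inverted, which is possible
    as \<open>d \<ge> 1\<close>.\<close>
  then have "g dvd const (1 / of_nat d) * (of_nat d * f)"
    unfolding euler_identity[OF f(1)] by (rule dvd_mult)
  then have "g dvd f"
    using f(2) by (simp add: mult.assoc[symmetric] flip: const_of_nat const_mult)
  then obtain h where h: "f = g * h" by (elim dvdE)
  have "\<not> g dvd h"
    using sqf nu unfolding squarefree_def h by (metis dvd_def mult.assoc power2_eq_square)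
  have "pderiv4 i g = 0" for i
  proof -
    have "g dvd pderiv4 i g * h + g * pderiv4 i h"
      using g_dvd[of i] by (simp add: h pderiv4_mult)
    then have "g dvd pderiv4 i g * h" by (simp add: dvd_add_left_iff)
    then have "g dvd pderiv4 i g" using g_prime \<open>\<not> g dvd h\<close> by blast
    then show ?thesis by (rule dvd_pderiv4_imp_zero)
  qed
  then have "g = const (Poly_Mapping.lookup g 0)"
    by (intro forms_0_const pderiv4_all_zero)
  then show False using nu g0 const_dvd_one by (metis const_eq_0_iff)
qed

text \<open>Fix a nonzero f_k. By proportionality it divides v_k f_j for every j, hence v_k times
  the gcd of all f_j, which is a unit. The quotient of v_k by f_k then works for all
  coordinates.\<close>

lemma proportional_to_gradient:
  assumes f: "f \<in> forms d" "d \<ge> 1" "f \<noteq> 0" "squarefree f"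
    and ratio: "\<And>i j. v i * pderiv4 j f = v j * pderiv4 i f"
  shows "\<exists>h. \<forall>i. v i = h * pderiv4 i f"
proof -
  let ?F = "\<lambda>i. nested (pderiv4 i f)"
  obtain k where k: "pderiv4 k f \<noteq> 0"
    using exists_pderiv4_nonzero[OF f(1-3)] .
  define u where "u = Gcd (range ?F)"
  have unit: "is_unit u"
    by (rule squarefree_gradient_coprime[OF f]) (simp add: u_def Gcd_dvd del: Gcd_image_normalize)
  have "?F k dvd nested (v k) * x" if "x \<in> range ?F" for x
  proof -
    obtain j where "x = ?F j" using \<open>x \<in> range ?F\<close> by blast
    then have "nested (v k) * x = nested (v j) * ?F k"
      using ratio[of k j] by (simp flip: nested_mult)
    then show ?thesis by simp
  qed
  then have "?F k dvd y" if "y \<in> (*) (nested (v k)) ` range ?F" for y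
    using that by blast
  then have "?F k dvd Gcd ((*) (nested (v k)) ` range ?F)"
    by (rule Gcd_greatest)
  then have "?F k dvd nested (v k) * u"
    unfolding u_def Gcd_mult by (simp only: dvd_normalize_iff)
  then have "?F k dvd nested (v k)"
    by (simp only: dvd_mult_unit_iff[OF unit])
  then have "pderiv4 k f dvd v k"
    by (simp only: nested_dvd_iff)
  then obtain h where "v k = pderiv4 k f * h"
    by (elim dvdE)
  then have h: "v k = h * pderiv4 k f"
    by (simp only: mult.commute)
  have "v i = h * pderiv4 i f" for i
  proof -
    have "v i * pderiv4 k f = h * pderiv4 i f * pderiv4 k f"
      unfolding ratio[of i k] h by (simp only: mult_ac)
    then show ?thesis by (simp only: mult_right_cancel[OF k])
  qed
  then show ?thesis by blast
qed

subsection \<open>Substitutions and cones\<close>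

interpretation subst: coeff_hom const
  by standard (simp_all add: const_add const_mult)

lemma linear_subst_eq: "linear_subst A = poly_eval const (\<lambda>i. \<Sum>j\<in>UNIV. const (A $ i $ j) * var j)"
  by (simp add: fun_eq_iff linear_subst_def poly_eval_def)

text \<open>The chain rule: x_i is replaced by row \<open>i\<close> of \<open>A\<close>, so the
  derivative in x_k picks out column \<open>k\<close>.\<close>

lemma pderiv4_linear_subst:
  "pderiv4 k (linear_subst A p) = (\<Sum>i\<in>UNIV. const (A $ i $ k) * linear_subst A (pderiv4 i p))"
proof -
  have one: "linear_subst A 1 = 1"
    using subst.poly_eval_const[of _ 1] by (simp add: linear_subst_eq)
  have zero: "linear_subst A 0 = 0"
    using subst.poly_eval_const[of _ 0] by (simp add: linear_subst_eq)
  show ?thesis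
  proof (induction p rule: mpoly4_induct)
    case (const c)
    then show ?case by (simp add: linear_subst_eq subst.poly_eval_const zero[unfolded linear_subst_eq])
  next
    case (var i)
    have "const (A $ j $ k) * linear_subst A (pderiv4 j (var i)) = (if j = i then const (A $ i $ k) else 0)" for j
      by (simp add: pderiv4_var one zero)
    moreover have "pderiv4 k (const (A $ i $ j) * var j) = (if j = k then const (A $ i $ k) else 0)" for j
      by (simp add: pderiv4_mult pderiv4_var)
    ultimately show ?case
      by (simp add: linear_subst_eq[of A] subst.poly_eval_var pderiv4_sum)
  next
    case (add p q)
    then show ?case
      by (simp add: linear_subst_eq subst.poly_eval_add pderiv4_add sum.distrib algebra_simps)
  next
    case (mult p q)
    have "linear_subst A (pderiv4 i (p * q)) =
        linear_subst A (pderiv4 i p) * linear_subst A q + linear_subst A p * linear_subst A (pderiv4 i q)" for i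
      by (simp add: linear_subst_eq subst.poly_eval_add pderiv4_mult subst.poly_eval_mult)
    moreover have "pderiv4 k (linear_subst A (p * q)) =
        pderiv4 k (linear_subst A p) * linear_subst A q + linear_subst A p * pderiv4 k (linear_subst A q)"
      by (simp add: linear_subst_eq subst.poly_eval_mult pderiv4_mult)
    ultimately show ?case
      by (simp only: mult distrib_left sum.distrib sum_distrib_left sum_distrib_right mult_ac)
  qed
qed

text \<open>The other columns are the standard basis vectors except the one with index
  \<open>k\<close>; since \<open>c k\<close> is nonzero, the column \<open>c\<close> completes them
  to a basis.\<close>

lemma exists_invertible_with_last_column:
  fixes c :: "4 \<Rightarrow> complex"
  assumes "c k \<noteq> 0"
  shows "\<exists>A :: complex ^ 4 ^ 4. invertible A \<and> (\<forall>i. A $ i $ 3 = c i)"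
proof -
  define \<sigma> where "\<sigma> = Transposition.transpose k (3 :: 4)"
  define A :: "complex ^ 4 ^ 4"
    where "A = (\<chi> i j. if j = 3 then c i else if j = \<sigma> i then 1 else 0)"
  have A_mult: "(A *v x) $ i = c i * x $ 3 + (if \<sigma> i = 3 then 0 else x $ \<sigma> i)" for x i
  proof -
    have "(A *v x) $ i = (\<Sum>j\<in>UNIV. (if j = 3 then c i else if j = \<sigma> i then 1 else 0) * x $ j)"
      by (simp add: matrix_vector_mult_def A_def)
    also have "\<dots> = (\<Sum>j\<in>UNIV. (if j = 3 then c i * x $ 3 else 0) +
        (if j = \<sigma> i then if \<sigma> i = 3 then 0 else x $ \<sigma> i else 0))"
      by (rule sum.cong) auto
    finally show ?thesis by (simp add: sum.distrib)
  qed
  have "x = 0" if "A *v x = 0" for x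
  proof -
    \<comment> \<open>The only possibly nonzero entry of row \<open>k\<close> is \<open>c k\<close>
      in column 3, because \<sigma> sends \<open>k\<close> to 3.\<close>
    have 3: "x $ 3 = 0"
      using A_mult[of x k] that assms by (simp add: \<sigma>_def)
    have "x $ j = 0" for j
    proof (cases "j = 3")
      case False
      have "\<sigma> (\<sigma> j) = j" by (simp add: \<sigma>_def)
      then show ?thesis using A_mult[of x "\<sigma> j"] that 3 False by simp
    qed (use 3 in simp)
    then show ?thesis by (simp add: vec_eq_iff)
  qed
  then have "invertible A"
    unfolding invertible_left_inverse matrix_left_invertible_ker by blast
  then show ?thesis by (auto simp: A_def)
qed

text \<open>A coordinate change with last column \<open>c\<close> turns the constant vector field
  with coefficients \<open>c i\<close> into the derivative in the last variable; in characteristic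
  zero its vanishing removes that variable from the equation.\<close>

lemma constant_syzygy_imp_cone:
  assumes "c k \<noteq> 0" and syz: "(\<Sum>i\<in>UNIV. const (c i) * pderiv4 i f) = 0"
  shows "is_cone f"
proof -
  obtain A :: "complex ^ 4 ^ 4" where A: "invertible A" "\<And>i. A $ i $ 3 = c i"
    using exists_invertible_with_last_column assms(1) by metis
  have "linear_subst A (\<Sum>i\<in>UNIV. const (c i) * pderiv4 i f) = pderiv4 3 (linear_subst A f)"
    unfolding pderiv4_linear_subst
    by (simp add: linear_subst_eq subst.poly_eval_sum subst.poly_eval_mult subst.poly_eval_const A)
  then have d0: "pderiv4 3 (linear_subst A f) = 0"
    using syz subst.poly_eval_const[of _ 0] by (simp add: linear_subst_eq)
  have "Poly_Mapping.lookup m 3 = 0" if m: "m \<in> Poly_Mapping.keys (linear_subst A f)" for m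
  proof (rule ccontr)
    assume nz: "Poly_Mapping.lookup m 3 \<noteq> 0"
    have "m = (m - Poly_Mapping.single 3 1) + Poly_Mapping.single 3 1"
      by (rule poly_mapping_eqI) (use nz in \<open>auto simp: lookup_add lookup_single lookup_minus when_def\<close>)
    then show False
      using lookup_pderiv4[of 3 "linear_subst A f" "m - Poly_Mapping.single 3 1"] nz d0 m
      by (simp add: lookup_minus in_keys_iff del: of_nat_Suc)
  qed
  then show ?thesis unfolding is_cone_def using A(1) by blast
qed

subsection \<open>Ideals generated by linear forms\<close>

text \<open>Being congruent to its own image modulo \<open>I\<close> passes from the variables to
  sums and products. In particular the kernel of the substitution lies in \<open>I\<close>.\<close>

lemma poly_eval_congruent:
  assumes I: "ideals.subspace I" and y: "\<And>i. var i - y i \<in> I"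
  shows "p - poly_eval const y p \<in> I"
proof (induction p rule: mpoly4_induct)
  case (const c)
  then show ?case by (simp add: subst.poly_eval_const ideals.subspace_0[OF I])
next
  case (var i)
  then show ?case by (simp add: subst.poly_eval_var y)
next
  case (add p q)
  then show ?case
    using ideals.subspace_add[OF I] by (fastforce simp: subst.poly_eval_add add_diff_add)
next
  case (mult p q)
  let ?e = "poly_eval const y"
  have "p * q - ?e (p * q) = ?e q * (p - ?e p) + p * (q - ?e q)"
    by (simp add: subst.poly_eval_mult algebra_simps)
  then show ?case
    using mult ideals.subspace_add[OF I] ideals.subspace_scale[OF I] by simp
qed

text \<open>Euler's identity in degree one, where the partial derivatives are constants.\<close>

lemma linear_form_expand:
  assumes "l \<in> forms 1"
  obtains a where "l = (\<Sum>i\<in>UNIV. const (a i) * var i)"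
proof -
  have "pderiv4 i l = const (Poly_Mapping.lookup (pderiv4 i l) 0)" for i
    using assms by (intro forms_0_const pderiv4_in_forms) simp
  then have "(\<Sum>i\<in>UNIV. const (Poly_Mapping.lookup (pderiv4 i l) 0) * var i) = l"
    using euler_identity[OF assms] by (simp add: mult.commute)
  then show ?thesis using that[of "\<lambda>i. Poly_Mapping.lookup (pderiv4 i l) 0"] by simp
qed

definition linear_pair :: "mpoly4 \<Rightarrow> mpoly4 \<Rightarrow> bool" where
  "linear_pair l1 l2 \<longleftrightarrow> l1 \<in> forms 1 \<and> l2 \<in> forms 1 \<and>
     (\<forall>\<alpha> \<beta>. const \<alpha> * l1 + const \<beta> * l2 = 0 \<longrightarrow> \<alpha> = 0 \<and> \<beta> = 0)"

lemma linear_pair_nonzero: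
  assumes "linear_pair l1 l2" shows "l1 \<noteq> 0" "l2 \<noteq> 0"
proof -
  show "l1 \<noteq> 0"
  proof
    assume "l1 = 0"
    then have "const 1 * l1 + const 0 * l2 = 0" by simp
    then show False using assms unfolding linear_pair_def by (metis one_neq_zero)
  qed
  show "l2 \<noteq> 0"
  proof
    assume "l2 = 0"
    then have "const 0 * l1 + const 1 * l2 = 0" by simp
    then show False using assms unfolding linear_pair_def by (metis one_neq_zero)
  qed
qed

text \<open>Solving \<open>l = 0\<close> for a variable x_k that occurs in \<open>l\<close> gives a
  substitution that kills \<open>l\<close> and is the identity modulo \<open>l\<close>. The images
  of \<open>p\<close> and \<open>q\<close> then have product zero in a domain.\<close>

lemma linear_form_prime:
  assumes l: "l \<in> forms 1" "l \<noteq> 0" and dvd: "l dvd p * q"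
  shows "l dvd p \<or> l dvd q"
proof -
  obtain a where a: "l = (\<Sum>i\<in>UNIV. const (a i) * var i)"
    using linear_form_expand l(1) .
  obtain k where k: "a k \<noteq> 0"
    using l(2) a by (metis (no_types, lifting) const_simps(1) mult_zero_left sum.neutral)
  define y where "y i = (if i = k then var k - const (1 / a k) * l else var i)" for i
  let ?e = "poly_eval const y"
  have el: "?e l = 0"
  proof -
    have "?e l = (\<Sum>i\<in>UNIV. const (a i) * y i)"
      unfolding a by (simp add: subst.poly_eval_sum subst.poly_eval_mult subst.poly_eval_const subst.poly_eval_var)
    also have "\<dots> = (\<Sum>i\<in>UNIV. const (a i) * var i - (if i = k then const (a k) * const (1 / a k) * l else 0))"
      by (intro sum.cong refl) (simp only: y_def right_diff_distrib mult.assoc diff_zero split: if_split, blast)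
    also have "\<dots> = 0"
      using k by (simp add: sum_subtractf sum.delta flip: const_mult a)
    finally show ?thesis .
  qed
  have sub: "ideals.subspace {p. l dvd p}"
    by (auto simp: ideals.subspace_def)
  have cong: "l dvd p - ?e p" for p
    using poly_eval_congruent[OF sub, of y p] by (auto simp: y_def)
  obtain r where "p * q = l * r" using dvd by (elim dvdE)
  then have "?e p * ?e q = ?e l * ?e r"
    by (simp flip: subst.poly_eval_mult)
  then have "?e p * ?e q = 0" by (simp add: el)
  then show ?thesis using cong[of p] cong[of q] by auto
qed

definition pair_ideal :: "mpoly4 \<Rightarrow> mpoly4 \<Rightarrow> mpoly4 set" where
  "pair_ideal l1 l2 = {u * l1 + w * l2 | u w. True}"

lemma subspace_pair_ideal: "ideals.subspace (pair_ideal l1 l2)"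
proof (rule ideals.subspaceI)
  show "0 \<in> pair_ideal l1 l2"
    unfolding pair_ideal_def by (rule CollectI, intro exI[of _ 0]) simp
  fix p q assume "p \<in> pair_ideal l1 l2" "q \<in> pair_ideal l1 l2"
  then obtain u w u' w' where "p = u * l1 + w * l2" "q = u' * l1 + w' * l2"
    unfolding pair_ideal_def by blast
  then have "p + q = (u + u') * l1 + (w + w') * l2" by (simp add: algebra_simps)
  then show "p + q \<in> pair_ideal l1 l2" unfolding pair_ideal_def by blast
next
  fix c p assume "p \<in> pair_ideal l1 l2"
  then obtain u w where "p = u * l1 + w * l2"
    unfolding pair_ideal_def by blast
  then have "c * p = (c * u) * l1 + (c * w) * l2" by (simp only: distrib_left mult.assoc)
  then show "c * p \<in> pair_ideal l1 l2" unfolding pair_ideal_def by blast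
qed

text \<open>
  Cramer's rule for a nonzero minor yields a substitution which kills $l_1,l_2$ and is the identity modulo
  $(l_1,l_2)$; its kernel is therefore $(l_1,l_2)$, which is thus prime.
\<close>

lemma linear_pair_substitution:
  assumes pair: "linear_pair l1 l2"
  obtains y k where "poly_eval const y l1 = 0" "poly_eval const y l2 = 0"
    "\<And>i. var i - y i \<in> pair_ideal l1 l2" "y k = var k"
proof -
  have l: "l1 \<in> forms 1" "l2 \<in> forms 1" using pair by (simp_all add: linear_pair_def)
  obtain a where a: "l1 = (\<Sum>i\<in>UNIV. const (a i) * var i)" using linear_form_expand l(1) .
  obtain b where b: "l2 = (\<Sum>i\<in>UNIV. const (b i) * var i)" using linear_form_expand l(2) .
  have "\<exists>i j. a i * b j \<noteq> a j * b i"
  proof (rule ccontr)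
    assume no: "\<not> ?thesis"
    have "\<exists>i. a i \<noteq> 0"
      using linear_pair_nonzero(1)[OF pair] a
      by (metis (no_types, lifting) const_simps(1) mult_zero_left sum.neutral)
    then obtain i where i: "a i \<noteq> 0" by blast
    \<comment> \<open>If all minors vanish, this combination is zero although the coefficient
      \<open>a i\<close> is not.\<close>
    have "const (- b i) * l1 + const (a i) * l2 =
        (\<Sum>j\<in>UNIV. const (- b i) * (const (a j) * var j) + const (a i) * (const (b j) * var j))"
      by (simp only: a b sum_distrib_left sum.distrib)
    also have "\<dots> = (\<Sum>j\<in>UNIV. const (a i * b j - a j * b i) * var j)"
      by (intro sum.cong refl) (simp only: const_diff const_mult const_uminus, algebra)
    also have "\<dots> = 0" using no by simp
    finally show False using pair i unfolding linear_pair_def by blast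
  qed
  then obtain i j where D: "a i * b j - a j * b i \<noteq> 0" by auto
  then have ij: "i \<noteq> j" by auto
  define D where "D = a i * b j - a j * b i"
  \<comment> \<open>\<open>m\<close> and \<open>n\<close> solve
    \<open>l1 = a i * m + a j * n\<close> and \<open>l2 = b i * m + b j * n\<close>. Subtracting
    them from x_i and x_j therefore kills both forms.\<close>
  define m where "m = const (b j / D) * l1 - const (a j / D) * l2"
  define n where "n = const (a i / D) * l2 - const (b i / D) * l1"
  define y where "y k = (if k = i then var i - m else if k = j then var j - n else var k)" for k
  let ?e = "poly_eval const y"
  have e: "?e (\<Sum>k\<in>UNIV. const (g k) * var k) =
      (\<Sum>k\<in>UNIV. const (g k) * var k) - const (g i) * m - const (g j) * n" for g
  proof -
    have "?e (\<Sum>k\<in>UNIV. const (g k) * var k) = (\<Sum>k\<in>UNIV. const (g k) * y k)"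
      by (simp add: subst.poly_eval_sum subst.poly_eval_mult subst.poly_eval_const subst.poly_eval_var)
    also have "\<dots> = (\<Sum>k\<in>UNIV. const (g k) * var k - (if k = i then const (g i) * m else 0)
        - (if k = j then const (g j) * n else 0))"
      by (rule sum.cong) (use ij in \<open>auto simp only: y_def right_diff_distrib diff_zero refl split: if_split\<close>)
    finally show ?thesis by (simp add: sum_subtractf)
  qed
  have el1: "?e l1 = 0"
  proof -
    have "const (a i) * m + const (a j) * n =
        const (a i * (b j / D) - a j * (b i / D)) * l1 + const (a j * (a i / D) - a i * (a j / D)) * l2"
      by (simp only: m_def n_def const_diff const_mult) algebra
    moreover have "a i * (b j / D) - a j * (b i / D) = 1" "a j * (a i / D) - a i * (a j / D) = 0"
      using D by (simp_all add: D_def flip: diff_divide_distrib)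
    ultimately show ?thesis using e[of a] by (simp add: diff_diff_eq flip: a)
  qed
  have el2: "?e l2 = 0"
  proof -
    have "const (b i) * m + const (b j) * n =
        const (b i * (b j / D) - b j * (b i / D)) * l1 + const (b j * (a i / D) - b i * (a j / D)) * l2"
      by (simp only: m_def n_def const_diff const_mult) algebra
    moreover have "b i * (b j / D) - b j * (b i / D) = 0" "b j * (a i / D) - b i * (a j / D) = 1"
      using D by (simp_all add: D_def mult.commute flip: diff_divide_distrib)
    ultimately show ?thesis using e[of b] by (simp add: diff_diff_eq flip: b)
  qed
  have m: "m \<in> pair_ideal l1 l2"
    unfolding pair_ideal_def m_def
    by (rule CollectI, intro exI[of _ "const (b j / D)"] exI[of _ "- const (a j / D)"]) simp
  have n: "n \<in> pair_ideal l1 l2"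
    unfolding pair_ideal_def n_def
    by (rule CollectI, intro exI[of _ "- const (b i / D)"] exI[of _ "const (a i / D)"]) simp
  have "var k - y k \<in> pair_ideal l1 l2" for k
    using m n ideals.subspace_0[OF subspace_pair_ideal] by (simp add: y_def)
  \<comment> \<open>Of the four variables only two are altered; a third one stays fixed and
    witnesses that the ideal does not contain all variables.\<close>
  moreover obtain k where "k \<notin> {i, j}"
  proof -
    have "card {i, j} < card (UNIV :: 4 set)" using card_insert_le_m1[of 2 "{j}" i] by simp
    then show ?thesis using that by (metis UNIV_I less_irrefl subsetI subset_UNIV equalityI)
  qed
  ultimately show ?thesis using that[of y k] el1 el2 by (simp add: y_def)
qed

lemma poly_eval_pair_ideal:
  assumes "poly_eval const y l1 = 0" "poly_eval const y l2 = 0" "p \<in> pair_ideal l1 l2"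
  shows "poly_eval const y p = 0"
  using assms by (auto simp: pair_ideal_def subst.poly_eval_add subst.poly_eval_mult)

lemma linear_pair_prime:
  assumes "linear_pair l1 l2" "p * q \<in> pair_ideal l1 l2"
  shows "p \<in> pair_ideal l1 l2 \<or> q \<in> pair_ideal l1 l2"
proof -
  obtain y k where y: "poly_eval const y l1 = 0" "poly_eval const y l2 = 0"
    "\<And>i. var i - y i \<in> pair_ideal l1 l2"
    using linear_pair_substitution[OF assms(1)] by metis
  have "poly_eval const y p * poly_eval const y q = 0"
    using poly_eval_pair_ideal[OF y(1,2) assms(2)] by (simp add: subst.poly_eval_mult)
  then show ?thesis
    using poly_eval_congruent[OF subspace_pair_ideal y(3)] by (metis diff_zero mult_eq_0_iff)
qed

text \<open>The substitution kills the ideal but fixes the nonzero \<open>var k\<close>. This will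
  show that B(f) is a proper ideal.\<close>

lemma linear_pair_not_all_vars:
  assumes "linear_pair l1 l2"
  obtains k where "var k \<notin> pair_ideal l1 l2"
proof -
  obtain y k where y: "poly_eval const y l1 = 0" "poly_eval const y l2 = 0" "y k = var k"
    using linear_pair_substitution[OF assms] by metis
  have "var k \<noteq> 0" by (metis pderiv4_var pderiv4_zero zero_neq_one)
  then have "var k \<notin> pair_ideal l1 l2"
    using poly_eval_pair_ideal[OF y(1,2)] y(3) by (metis subst.poly_eval_var)
  then show ?thesis by (rule that)
qed

text \<open>Independent linear forms are a regular sequence: the prime \<open>l2\<close> does not
  divide \<open>l1\<close>, since for degree reasons the quotient would be a constant, so it divides
  \<open>u\<close>.\<close>

lemma linear_pair_koszul:
  assumes pair: "linear_pair l1 l2" and eq: "u * l1 = w * l2"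
  shows "\<exists>t. u = t * l2 \<and> w = t * l1"
proof -
  have l: "l1 \<in> forms 1" "l2 \<in> forms 1" using pair by (simp_all add: linear_pair_def)
  note nz = linear_pair_nonzero[OF pair]
  have "\<not> l2 dvd l1"
  proof
    assume "l2 dvd l1"
    then obtain c where c: "l1 = c * l2" by (metis dvdE mult.commute)
    then have "c \<in> forms 0" using form_divide[of c l2 0 1] l nz by simp
    then obtain \<gamma> where "c = const \<gamma>" using forms_0_const by blast
    then have "const 1 * l1 + const (- \<gamma>) * l2 = 0" by (simp add: c const_uminus)
    then show False using pair unfolding linear_pair_def by (metis one_neq_zero)
  qed
  moreover have "l2 dvd u * l1" by (simp add: eq)
  ultimately have "l2 dvd u" using linear_form_prime l nz by blast
  then obtain t where t: "u = t * l2" by (metis dvdE mult.commute)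
  then have "w * l2 = (t * l1) * l2" unfolding eq[symmetric] by (simp only: mult_ac)
  then have "w = t * l1" by (simp only: mult_right_cancel[OF nz(2)])
  then show ?thesis using t by blast
qed

section \<open>Two-dimensional spaces of linear forms\<close>

lemma dim_eq_2_imp_linear_pair:
  assumes "V \<subseteq> forms 1" "cpoly.dim V = 2"
  obtains l1 l2 where "linear_pair l1 l2" "l1 \<in> V" "l2 \<in> V" "V \<subseteq> pair_ideal l1 l2"
proof -
  obtain B where B: "B \<subseteq> V" "cpoly.independent B" "V \<subseteq> cpoly.span B" "card B = 2"
    using cpoly.basis_exists[of V] assms(2) by metis
  obtain l1 l2 where l: "B = {l1, l2}" "l1 \<noteq> l2"
    using B(4) by (auto simp: card_2_iff)
  have "\<alpha> = 0 \<and> \<beta> = 0" if z: "const \<alpha> * l1 + const \<beta> * l2 = 0" for \<alpha> \<beta>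
  proof -
    let ?u = "\<lambda>v. if v = l1 then \<alpha> else \<beta>"
    have "(\<Sum>v\<in>B. const (?u v) * v) = 0" using l z by simp
    then have "\<forall>v\<in>B. ?u v = 0"
      using B(2) l(1) cpoly.independentD[of B B ?u] by blast
    then show ?thesis using l by auto
  qed
  then have "linear_pair l1 l2" using B l assms unfolding linear_pair_def by blast
  moreover have "cpoly.span B \<subseteq> pair_ideal l1 l2"
  proof (rule cpoly.span_minimal)
    have "l1 = 1 * l1 + 0 * l2" "l2 = 0 * l1 + 1 * l2" by simp_all
    then show "B \<subseteq> pair_ideal l1 l2" unfolding l pair_ideal_def by blast
    show "cpoly.subspace (pair_ideal l1 l2)"
      using subspace_pair_ideal[of l1 l2] unfolding cpoly.subspace_def ideals.subspace_def by blast
  qed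
  ultimately show ?thesis using B(1,3) unfolding l(1) by (intro that[of l1 l2]) auto
qed

lemma linear_pair_imp_dim_eq_2:
  assumes pair: "linear_pair l1 l2" and V: "V = {const \<alpha> * l1 + const \<beta> * l2 | \<alpha> \<beta>. True}"
  shows "cpoly.dim V = 2"
proof -
  have ne: "l1 \<noteq> l2"
  proof
    assume "l1 = l2"
    then have "const 1 * l1 + const (- 1) * l2 = 0" by (simp add: const_uminus)
    then show False using pair unfolding linear_pair_def by (metis one_neq_zero)
  qed
  have "cpoly.independent {l1, l2}"
  proof (rule cpoly.independent_if_scalars_zero)
    fix g x assume "(\<Sum>x\<in>{l1, l2}. const (g x) * x) = 0" "x \<in> {l1, l2}"
    then show "g x = 0" using pair ne unfolding linear_pair_def by auto
  qed simp
  moreover have "cpoly.span {l1, l2} = cpoly.span V"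
  proof (rule cpoly.span_eq[THEN iffD2], intro conjI)
    have "l1 = const 1 * l1 + const 0 * l2" "l2 = const 0 * l1 + const 1 * l2" by simp_all
    then have "{l1, l2} \<subseteq> V" unfolding V by blast
    then show "{l1, l2} \<subseteq> cpoly.span V" using cpoly.span_superset by blast
    show "V \<subseteq> cpoly.span {l1, l2}"
      unfolding V by clarify (intro cpoly.span_add cpoly.span_scale cpoly.span_base; simp)
  qed
  ultimately show ?thesis using cpoly.dim_eq_card[of "{l1, l2}" V] ne by simp
qed

subsection \<open>The form $\omega(\rho_1)\wedge\omega(\rho_2)\wedge\omega(\rho)$\<close>

lemma form_of_nth: "form_of a $ I = (\<Sum>i\<in>UNIV. if I = {i} then a $ i else 0)"
  unfolding form_of_def basis_form_def sum_component
  by (intro sum.cong refl) (simp only: vector_smult_component axis_def vec_lambda_beta mult_1_right mult_zero_right if_distrib[of "(*) _"])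

lemma form_of_singleton [simp]: "form_of a $ {i} = a $ i"
  unfolding form_of_nth by simp

lemma form_of_not_singleton: "card I \<noteq> 1 \<Longrightarrow> form_of a $ I = 0"
  unfolding form_of_nth by (intro sum.neutral) auto

text \<open>A 1-form lives on singletons, so only the splittings of K into \<open>K - {k}\<close>
  and \<open>{k}\<close> contribute; their inversions are the elements of K above
  \<open>k\<close>.\<close>

lemma wedge_form_of:
  "wedge \<eta> (form_of c) $ K =
     (\<Sum>k\<in>K. (- 1) ^ card {i \<in> K - {k}. k < i} * \<eta> $ (K - {k}) * c $ k)"
proof -
  define s where "s I = (- 1 :: mpoly4) ^ card {(i, j). i \<in> I \<and> j \<in> K - I \<and> j < i} * \<eta> $ I" for I
  have inner: "(\<Sum>I\<in>Pow K. s I * (if K - I = {k} then c $ k else 0)) =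
      (if k \<in> K then (- 1) ^ card {i \<in> K - {k}. k < i} * \<eta> $ (K - {k}) * c $ k else 0)" for k
  proof (cases "k \<in> K")
    case True
    have "K - I = {k} \<longleftrightarrow> I = K - {k}" if "I \<in> Pow K" for I
      using that True by blast
    then have "(\<Sum>I\<in>Pow K. s I * (if K - I = {k} then c $ k else 0)) =
        (\<Sum>I\<in>Pow K. if I = K - {k} then s (K - {k}) * c $ k else 0)"
      by (intro sum.cong refl) (auto simp only: mult_zero_right split: if_split)
    also have "\<dots> = s (K - {k}) * c $ k"
      by (subst sum.delta) auto
    finally have 1: "(\<Sum>I\<in>Pow K. s I * (if K - I = {k} then c $ k else 0)) = s (K - {k}) * c $ k" .
    have "{(i, j). i \<in> K - {k} \<and> j \<in> K - (K - {k}) \<and> j < i} = (\<lambda>i. (i, k)) ` {i \<in> K - {k}. k < i}"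
      using True by blast
    moreover have "card ((\<lambda>i. (i, k)) ` {i \<in> K - {k}. k < i}) = card {i \<in> K - {k}. k < i}"
      by (rule card_image) (simp add: inj_on_def)
    ultimately have "s (K - {k}) = (- 1) ^ card {i \<in> K - {k}. k < i} * \<eta> $ (K - {k})"
      unfolding s_def by (simp only:)
    then show ?thesis unfolding 1 using True by (simp only: if_True)
  next
    case False
    then have "K - I \<noteq> {k}" for I by blast
    then show ?thesis using False by (simp only: if_False mult_zero_right sum.neutral_const)
  qed
  have "wedge \<eta> (form_of c) $ K = (\<Sum>I\<in>Pow K. \<Sum>k\<in>UNIV. s I * (if K - I = {k} then c $ k else 0))"
    unfolding wedge_def vec_lambda_beta form_of_nth s_def sum_distrib_left ..
  also have "\<dots> = (\<Sum>k\<in>UNIV. \<Sum>I\<in>Pow K. s I * (if K - I = {k} then c $ k else 0))"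
    by (rule sum.swap)
  also have "\<dots> = (\<Sum>k\<in>UNIV. if k \<in> K then (- 1) ^ card {i \<in> K - {k}. k < i} * \<eta> $ (K - {k}) * c $ k else 0)"
    unfolding inner ..
  also have "\<dots> = (\<Sum>k\<in>K. (- 1) ^ card {i \<in> K - {k}. k < i} * \<eta> $ (K - {k}) * c $ k)"
    by (simp only: sum.If_cases finite sum.neutral_const add_0_right Collect_mem_eq Int_UNIV_left)
  finally show ?thesis .
qed

lemma wedge_form_of_eq_0:
  assumes "\<And>I. card I \<noteq> n \<Longrightarrow> \<eta> $ I = 0" "card K \<noteq> Suc n"
  shows "wedge \<eta> (form_of c) $ K = 0"
  unfolding wedge_form_of
proof (rule sum.neutral, intro ballI)
  fix k assume "k \<in> K"
  then have "card (K - {k}) \<noteq> n" using assms(2) by (metis card_Suc_Diff1 finite)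
  then have "\<eta> $ (K - {k}) = 0" by (rule assms(1))
  then show "(- 1) ^ card {i \<in> K - {k}. k < i} * \<eta> $ (K - {k}) * c $ k = 0"
    by (simp only: mult_zero_left mult_zero_right)
qed

lemma wedge_two_forms:
  assumes "p < q"
  shows "wedge (form_of a) (form_of b) $ {p, q} = a $ p * b $ q - a $ q * b $ p"
proof -
  have sets: "{i \<in> {q}. p < i} = {q}" "{i \<in> {p}. q < i} = {}"
    "{p, q} - {p} = {q}" "{p, q} - {q} = {p}" "p \<notin> {q}"
    using assms by auto
  show ?thesis
    unfolding wedge_form_of
    by (simp only: sum.insert finite.intros empty_iff not_False_eq_True sum.empty add_0_right sets
        form_of_singleton) simp
qed

text \<open>The determinant of rows \<open>p\<close>, \<open>q\<close>, \<open>r\<close> of the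
  matrix with columns \<open>a\<close>, \<open>b\<close>, \<open>c\<close>, expanded along
  \<open>c\<close>.\<close>

definition minor3 :: "mpoly4 ^ 4 \<Rightarrow> mpoly4 ^ 4 \<Rightarrow> mpoly4 ^ 4 \<Rightarrow> 4 \<Rightarrow> 4 \<Rightarrow> 4 \<Rightarrow> mpoly4" where
  "minor3 a b c p q r = (a $ q * b $ r - a $ r * b $ q) * c $ p -
     (a $ p * b $ r - a $ r * b $ p) * c $ q + (a $ p * b $ q - a $ q * b $ p) * c $ r"

lemma wedge3_nth:
  assumes "p < q" "q < r"
  shows "wedge3 a b (form_of c) $ {p, q, r} = minor3 a b c p q r"
proof -
  have pr: "p < r" using assms by simp
  have sets: "{i \<in> {q, r}. p < i} = {q, r}" "{i \<in> {p, r}. q < i} = {r}"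
    "{i \<in> {p, q}. r < i} = {}"
    "{p, q, r} - {p} = {q, r}" "{p, q, r} - {q} = {p, r}" "{p, q, r} - {r} = {p, q}"
    "p \<notin> {q, r}" "q \<notin> {r}" "q \<noteq> r"
    using assms by auto
  have card: "card {q, r} = 2" using assms by simp
  show ?thesis
    unfolding wedge3_def wedge_form_of[of _ c] minor3_def
    by (simp only: sum.insert finite.intros empty_iff not_False_eq_True sum.empty add_0_right sets
        wedge_two_forms assms pr card) (simp add: left_diff_distrib)
qed

lemma wedge3_eq_0: "card K \<noteq> 3 \<Longrightarrow> wedge3 a b (form_of c) $ K = 0"
  unfolding wedge3_def
  by (rule wedge_form_of_eq_0[of 2]) (auto intro!: wedge_form_of_eq_0[of 1] form_of_not_singleton)

lemma contract_volume_eq_0: "card K \<noteq> 3 \<Longrightarrow> contract X (basis_form UNIV) $ K = 0"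
  unfolding contract_def vec_lambda_beta
proof (rule sum.neutral, intro ballI)
  fix i assume K: "card K \<noteq> 3" and "i \<in> - K"
  then have "card (insert i K) = Suc (card K)" by (intro card_insert_disjoint) auto
  then have "insert i K \<noteq> UNIV" using K by (intro notI) simp
  then show "(- 1) ^ card {j \<in> K. j < i} * X $ i * basis_form UNIV $ insert i K = 0"
    by (simp add: basis_form_def axis_def)
qed

lemma contract_volume:
  assumes "K = - {m}"
  shows "contract X (basis_form UNIV) $ K = (- 1) ^ card {j. j < m} * X $ m"
proof -
  have "- K = {m}" "insert m K = UNIV" "{j \<in> K. j < m} = {j. j < m}"
    using assms by auto
  then show ?thesis
    by (simp add: contract_def basis_form_def)
qed

lemma complements_4: "- {0} = {1, 2, 3 :: 4}" "- {1} = {0, 2, 3 :: 4}" "- {2} = {0, 1, 3 :: 4}" "- {3} = {0, 1, 2 :: 4}"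
  unfolding Compl_eq_Diff_UNIV UNIV_4_from_0 by auto

lemma card_3_cases:
  assumes "card (K :: 4 set) = 3"
  shows "K \<in> {- {0}, - {1}, - {2}, - {3}}"
proof -
  have "card (- K) = 1" using assms by (simp add: Compl_eq_Diff_UNIV card_Diff_subset)
  then obtain m where "- K = {m}" by (auto simp: card_1_singleton_iff)
  then have "K = - {m}" by blast
  moreover have "m \<in> {0, 1, 2, 3}" unfolding UNIV_4_from_0[symmetric] by (rule UNIV_I)
  ultimately show ?thesis by blast
qed

lemma card_below_4: "card {j. j < (0::4)} = 0" "card {j. j < (1::4)} = 1" "card {j. j < (2::4)} = 2" "card {j. j < (3::4)} = 3"
proof -
  have "\<forall>j. \<not> j < (0::4)" "\<forall>j. j < (1::4) \<longleftrightarrow> j = 0" "\<forall>j. j < (2::4) \<longleftrightarrow> j = 0 \<or> j = 1"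
    "\<forall>j. j < (3::4) \<longleftrightarrow> j = 0 \<or> j = 1 \<or> j = 2"
    unfolding all_4_from_0
    by (simp_all only: less_4 less_4[THEN less_not_sym] less_irrefl simp_thms
        less_4[THEN less_imp_neq] less_4[THEN less_imp_neq, THEN not_sym])
  then have "{j. j < (0::4)} = {}" "{j. j < (1::4)} = {0}" "{j. j < (2::4)} = {0, 1}" "{j. j < (3::4)} = {0, 1, 2}"
    by blast+
  then show "card {j. j < (0::4)} = 0" "card {j. j < (1::4)} = 1" "card {j. j < (2::4)} = 2" "card {j. j < (3::4)} = 3"
    by simp_all
qed

text \<open>The signs are those of the contraction of the volume form.\<close>

definition triple :: "mpoly4 ^ 4 \<Rightarrow> mpoly4 ^ 4 \<Rightarrow> mpoly4 ^ 4 \<Rightarrow> 4 \<Rightarrow> mpoly4" where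
  "triple a b c i = (if i = 0 then minor3 a b c 1 2 3 else if i = 1 then - minor3 a b c 0 2 3
     else if i = 2 then minor3 a b c 0 1 3 else - minor3 a b c 0 1 2)"

lemma triple_simps:
  "triple a b c 0 = minor3 a b c 1 2 3" "triple a b c 1 = - minor3 a b c 0 2 3"
  "triple a b c 2 = minor3 a b c 0 1 3" "triple a b c 3 = - minor3 a b c 0 1 2"
  by (simp_all add: triple_def)

text \<open>Both sides are 3-forms, so only the complements of singletons matter, and there the
  signs built into \<open>triple\<close> absorb those of the contraction. From here on the exterior
  algebra is replaced by four scalar equations.\<close>

lemma wedge3_eq_contract_iff:
  "wedge3 a b (form_of c) = h *s contract X (basis_form UNIV) \<longleftrightarrow> (\<forall>i. triple a b c i = h * X $ i)"
proof -
  let ?P = "\<lambda>K. wedge3 a b (form_of c) $ K = h * contract X (basis_form UNIV) $ K"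
  have "wedge3 a b (form_of c) = h *s contract X (basis_form UNIV) \<longleftrightarrow> (\<forall>K. ?P K)"
    by (simp only: vec_eq_iff vector_smult_component)
  also have "\<dots> \<longleftrightarrow> (\<forall>K\<in>{- {0}, - {1}, - {2}, - {3}}. ?P K)"
    using card_3_cases wedge3_eq_0 contract_volume_eq_0 by (metis mult_zero_right)
  also have "\<dots> \<longleftrightarrow> (\<forall>i. triple a b c i = h * X $ i)"
    unfolding all_4_from_0 ball_simps triple_simps contract_volume[OF refl] card_below_4
    unfolding complements_4 by (auto simp: wedge3_nth minus_equation_iff)
  finally show ?thesis .
qed

lemma wedge3_eq_0_iff: "wedge3 a b (form_of c) = 0 \<longleftrightarrow> (\<forall>i. triple a b c i = 0)"
  using wedge3_eq_contract_iff[of a b c 0 0] by (simp add: vec_eq_iff)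

text \<open>\<open>F\<close> and the vector of signed maximal minors are both orthogonal to
  \<open>a\<close>, \<open>b\<close> and \<open>c\<close>. The proportionality is a polynomial
  consequence of the three equations, valid without any rank assumption.\<close>

lemma triple_proportional:
  assumes "(\<Sum>i\<in>UNIV. a $ i * F i) = 0" "(\<Sum>i\<in>UNIV. b $ i * F i) = 0" "(\<Sum>i\<in>UNIV. c $ i * F i) = 0"
  shows "triple a b c i * F j = triple a b c j * F i"
proof -
  have "\<forall>i j. triple a b c i * F j = triple a b c j * F i"
    unfolding all_4_from_0 triple_simps minor3_def
    by (intro conjI; (rule refl | (insert assms[unfolded sum_UNIV_4], algebra)))
  then show ?thesis by blast
qed

lemma minor3_add: "minor3 a b (c + c') p q r = minor3 a b c p q r + minor3 a b c' p q r"
  and minor3_diff: "minor3 a b (c - c') p q r = minor3 a b c p q r - minor3 a b c' p q r"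
  and minor3_smult: "minor3 a b (s *s c) p q r = s * minor3 a b c p q r"
  and minor3_smult1: "minor3 (s *s a) b c p q r = s * minor3 a b c p q r"
  and minor3_smult2: "minor3 a (s *s b) c p q r = s * minor3 a b c p q r"
  and minor3_equal: "minor3 a b a p q r = 0" "minor3 a b b p q r = 0" "minor3 a a c p q r = 0"
  and minor3_rank2: "minor3 (x *s a + y *s b) (x' *s a + y' *s b) (s *s a + t *s b) p q r = 0"
  by (simp_all only: minor3_def vector_add_component vector_minus_component vector_smult_component
      vector_uminus_component) algebra+

lemma triple_add: "triple a b (c + c') i = triple a b c i + triple a b c' i"
  and triple_diff: "triple a b (c - c') i = triple a b c i - triple a b c' i"
  and triple_smult: "triple a b (s *s c) i = s * triple a b c i"
  and triple_smult1: "triple (s *s a) b c i = s * triple a b c i"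
  and triple_smult2: "triple a (s *s b) c i = s * triple a b c i"
  and triple_equal: "triple a b a i = 0" "triple a b b i = 0" "triple a a c i = 0"
  and triple_rank2: "triple (x *s a + y *s b) (x' *s a + y' *s b) (s *s a + t *s b) i = 0"
  \<comment> \<open>The rank-two rule is applied before the multilinearity rules, which would
    destroy its left-hand side.\<close>
  unfolding triple_def minor3_rank2
  unfolding minor3_add minor3_diff minor3_smult minor3_smult1 minor3_smult2 minor3_equal
  by simp_all

text \<open>The 2-by-2 minors of \<open>a\<close> and \<open>b\<close> are forms of degree
  \<open>e1 + e2\<close>, so taking components affects only \<open>c\<close>.\<close>

lemma hom_component_triple:
  assumes "\<And>i. a $ i \<in> forms e1" "\<And>i. b $ i \<in> forms e2"
  shows "hom_component (q + (e1 + e2)) (triple a b c i) = triple a b (\<chi> k. hom_component q (c $ k)) i"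
proof -
  have "a $ i * b $ j - a $ k * b $ l \<in> forms (e1 + e2)" for i j k l
    by (intro forms_diff forms_mult assms)
  then have *: "hom_component (q + (e1 + e2)) ((a $ i * b $ j - a $ k * b $ l) * p) =
      (a $ i * b $ j - a $ k * b $ l) * hom_component q p" for i j k l p
    using hom_component_mult_form[of "a $ i * b $ j - a $ k * b $ l" "e1 + e2" "q + (e1 + e2)" p]
    by (simp add: mult.commute)
  have um: "hom_component n (- p) = - hom_component n p" for n p
    using hom_component_diff[of n 0 p] by simp
  show ?thesis
    unfolding triple_def minor3_def
    by (simp only: hom_component_add hom_component_diff um * vec_lambda_beta split: if_split) simp
qed

subsection \<open>The Bourbaki map\<close>

lemma in_AR_iff: "\<rho> \<in> AR f \<longleftrightarrow> (\<Sum>i\<in>UNIV. \<rho> $ i * pderiv4 i f) = 0"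
  by (simp add: AR_def)

lemma AR_add: "\<rho> \<in> AR f \<Longrightarrow> \<sigma> \<in> AR f \<Longrightarrow> \<rho> + \<sigma> \<in> AR f"
  by (simp add: in_AR_iff distrib_right sum.distrib)

lemma AR_diff: "\<rho> \<in> AR f \<Longrightarrow> \<sigma> \<in> AR f \<Longrightarrow> \<rho> - \<sigma> \<in> AR f"
  by (simp add: in_AR_iff left_diff_distrib sum_subtractf)

lemma AR_smult: "\<rho> \<in> AR f \<Longrightarrow> s *s \<rho> \<in> AR f"
  by (simp only: in_AR_iff vector_smult_component mult.assoc sum_distrib_left[symmetric] mult_zero_right)

definition hom_component_vec :: "nat \<Rightarrow> mpoly4 ^ 4 \<Rightarrow> mpoly4 ^ 4" where
  "hom_component_vec q \<rho> = (\<chi> i. hom_component q (\<rho> $ i))"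

lemma hom_component_vec_add: "hom_component_vec q (\<rho> + \<sigma>) = hom_component_vec q \<rho> + hom_component_vec q \<sigma>"
  by (simp add: hom_component_vec_def vec_eq_iff hom_component_add)

lemma hom_component_vec_smult:
  assumes "\<And>i. \<rho> $ i \<in> forms e"
  shows "hom_component_vec q (s *s \<rho>) = (if e \<le> q then hom_component (q - e) s else 0) *s \<rho>"
  by (simp add: hom_component_vec_def vec_eq_iff hom_component_mult_form[OF assms])

lemma hom_component_vec_form: "(\<And>i. \<rho> $ i \<in> forms q) \<Longrightarrow> hom_component_vec q \<rho> = \<rho>"
  by (simp add: hom_component_vec_def vec_eq_iff forms_iff_hom_component)

text \<open>The relation between the degrees is written with \<open>Suc\<close> and sums, so that no
  truncated subtraction of degrees occurs.\<close>

locale tame_surface =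
  fixes f :: mpoly4 and d e1 e2 e3 :: nat and \<rho>1 \<rho>2 :: "mpoly4 ^ 4"
  assumes reduced: "reduced_surface d f"
    and syz1: "\<rho>1 \<in> AR_deg f e1" and syz2: "\<rho>2 \<in> AR_deg f e2"
    and is_tame: "tame f \<rho>1 \<rho>2"
    and d_eq: "d = Suc (e1 + e2 + e3)"
begin

abbreviation "bmap \<equiv> bourbaki_map f \<rho>1 \<rho>2"

lemma f_facts: "f \<in> forms d" "d \<ge> 1" "f \<noteq> 0" "squarefree f"
  using reduced by (simp_all add: reduced_surface_def)

lemma syz_AR: "\<rho>1 \<in> AR f" "\<rho>2 \<in> AR f"
  and syz_forms: "\<rho>1 $ i \<in> forms e1" "\<rho>2 $ i \<in> forms e2"
  using syz1 syz2 by (simp_all add: AR_deg_def)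

lemma pderiv_forms: "pderiv4 i f \<in> forms (e3 + (e1 + e2))"
  using f_facts(1) by (intro pderiv4_in_forms) (simp add: d_eq ac_simps)

text \<open>Some partial derivative is nonzero and cancels, so the description by \<open>THE\<close>
  determines at most one value.\<close>

lemma bmap_unique:
  assumes "\<And>i. triple \<rho>1 \<rho>2 \<rho> i = h * pderiv4 i f"
  shows "bmap \<rho> = h"
proof -
  obtain k where k: "pderiv4 k f \<noteq> 0" using exists_pderiv4_nonzero[OF f_facts(1-3)] .
  have "h' = h" if "wedge3 \<rho>1 \<rho>2 (form_of \<rho>) = h' *s contract (gradient f) (basis_form UNIV)" for h'
  proof -
    have "h' * pderiv4 k f = h * pderiv4 k f"
      using that assms[of k] unfolding wedge3_eq_contract_iff by (simp add: gradient_def)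
    then show ?thesis by (simp only: mult_right_cancel[OF k])
  qed
  moreover have "wedge3 \<rho>1 \<rho>2 (form_of \<rho>) = h *s contract (gradient f) (basis_form UNIV)"
    unfolding wedge3_eq_contract_iff by (simp add: gradient_def assms)
  ultimately show ?thesis
    unfolding bourbaki_map_def by (intro the_equality)
qed

lemma triple_eq_bmap:
  assumes "\<rho> \<in> AR f"
  shows "triple \<rho>1 \<rho>2 \<rho> i = bmap \<rho> * pderiv4 i f"
proof -
  have "triple \<rho>1 \<rho>2 \<rho> i * pderiv4 j f = triple \<rho>1 \<rho>2 \<rho> j * pderiv4 i f" for i j
    using assms syz_AR by (intro triple_proportional) (simp_all add: in_AR_iff)
  then obtain h where "\<forall>i. triple \<rho>1 \<rho>2 \<rho> i = h * pderiv4 i f"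
    using proportional_to_gradient[OF f_facts] by blast
  then show ?thesis using bmap_unique by blast
qed

text \<open>This and the next rules transfer linearity of \<open>triple\<close> in its last argument
  to v' by uniqueness of the factor.\<close>

lemma bmap_add: "\<rho> \<in> AR f \<Longrightarrow> \<sigma> \<in> AR f \<Longrightarrow> bmap (\<rho> + \<sigma>) = bmap \<rho> + bmap \<sigma>"
  by (rule bmap_unique) (simp add: triple_add triple_eq_bmap distrib_right)

lemma bmap_diff: "\<rho> \<in> AR f \<Longrightarrow> \<sigma> \<in> AR f \<Longrightarrow> bmap (\<rho> - \<sigma>) = bmap \<rho> - bmap \<sigma>"
  by (rule bmap_unique) (simp add: triple_diff triple_eq_bmap left_diff_distrib)

lemma bmap_smult: "\<rho> \<in> AR f \<Longrightarrow> bmap (s *s \<rho>) = s * bmap \<rho>"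
  by (rule bmap_unique) (simp only: triple_smult triple_eq_bmap mult.assoc)

lemma bmap_syz: "bmap (a *s \<rho>1 + b *s \<rho>2) = 0"
  by (rule bmap_unique) (simp add: triple_add triple_smult triple_equal)

text \<open>Tameness, pulled back from forms to syzygies: \<open>form_of\<close> is injective, as
  its coefficients at singletons are the entries of the vector.\<close>

lemma bmap_eq_0:
  assumes "\<rho> \<in> AR f" "bmap \<rho> = 0"
  obtains a b where "\<rho> = a *s \<rho>1 + b *s \<rho>2"
proof -
  have lin: "a *s form_of \<rho>1 + b *s form_of \<rho>2 = form_of (a *s \<rho>1 + b *s \<rho>2)" for a b
    unfolding vec_eq_iff vector_add_component vector_smult_component form_of_nth sum_distrib_left
      sum.distrib[symmetric]
    by (intro allI sum.cong refl) (simp split: if_split)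
  have "wedge3 \<rho>1 \<rho>2 (form_of \<rho>) = 0"
    unfolding wedge3_eq_0_iff using assms by (simp add: triple_eq_bmap)
  then have "form_of \<rho> \<in> {\<omega> \<in> Omega1_0 f. wedge3 \<rho>1 \<rho>2 \<omega> = 0}"
    using assms(1) by (simp add: Omega1_0_def)
  then obtain a b where "form_of \<rho> = a *s form_of \<rho>1 + b *s form_of \<rho>2"
    using is_tame unfolding tame_def by auto
  then have eq: "form_of \<rho> = form_of (a *s \<rho>1 + b *s \<rho>2)" by (simp only: lin)
  have "\<rho> = a *s \<rho>1 + b *s \<rho>2"
    unfolding vec_eq_iff using arg_cong[OF eq, of "\<lambda>\<omega>. \<omega> $ {i}" for i] by simp
  then show ?thesis by (rule that)
qed

text \<open>All partial derivatives have the same degree, so a syzygy equation splits by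
  degree.\<close>

lemma hom_component_vec_AR:
  assumes "\<rho> \<in> AR f"
  shows "hom_component_vec q \<rho> \<in> AR_deg f q"
proof -
  have "(\<Sum>i\<in>UNIV. hom_component q (\<rho> $ i) * pderiv4 i f) =
      hom_component (q + (e3 + (e1 + e2))) (\<Sum>i\<in>UNIV. \<rho> $ i * pderiv4 i f)"
    by (simp add: hom_component_sum hom_component_mult_form[OF pderiv_forms])
  then show ?thesis
    using assms by (simp add: AR_deg_def in_AR_iff hom_component_vec_def)
qed

text \<open>Forming the minors raises the degree by \<open>e1 + e2\<close>, and dividing by a
  partial derivative lowers it by \<open>e1 + e2 + e3\<close>; hence v' lowers it by
  \<open>e3\<close>.\<close>

lemma bmap_hom_component:
  assumes "\<rho> \<in> AR f"
  shows "bmap (hom_component_vec (q + e3) \<rho>) = hom_component q (bmap \<rho>)"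
proof (rule bmap_unique)
  fix i
  have "triple \<rho>1 \<rho>2 (hom_component_vec (q + e3) \<rho>) i =
      hom_component (q + e3 + (e1 + e2)) (triple \<rho>1 \<rho>2 \<rho> i)"
    unfolding hom_component_vec_def by (rule hom_component_triple[symmetric]) (rule syz_forms)+
  also have "\<dots> = hom_component (q + (e3 + (e1 + e2))) (bmap \<rho> * pderiv4 i f)"
    by (simp only: triple_eq_bmap[OF assms] add.assoc)
  also have "\<dots> = hom_component q (bmap \<rho>) * pderiv4 i f"
    by (simp add: hom_component_mult_form[OF pderiv_forms])
  finally show "triple \<rho>1 \<rho>2 (hom_component_vec (q + e3) \<rho>) i = hom_component q (bmap \<rho>) * pderiv4 i f" .
qed

lemma bmap_forms:
  assumes "\<rho> \<in> AR_deg f (q + e3)"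
  shows "bmap \<rho> \<in> forms q"
proof -
  have "hom_component_vec (q + e3) \<rho> = \<rho>"
    using assms by (intro hom_component_vec_form) (simp add: AR_deg_def)
  then show ?thesis
    using bmap_hom_component[of \<rho> q] assms by (simp add: forms_iff_hom_component AR_deg_def)
qed

text \<open>Any preimage may be replaced by its component of degree \<open>1 + e3\<close>.\<close>

lemma bourbaki_ideal_linear_preimage:
  assumes "l \<in> bourbaki_ideal f \<rho>1 \<rho>2" "l \<in> forms 1"
  obtains r where "r \<in> AR_deg f (1 + e3)" "bmap r = l"
proof -
  obtain \<rho> where \<rho>: "\<rho> \<in> AR f" "bmap \<rho> = l"
    using assms(1) by (auto simp: bourbaki_ideal_def)
  then have "bmap (hom_component_vec (1 + e3) \<rho>) = l"
    using bmap_hom_component[of \<rho> 1] assms(2) by (simp add: forms_iff_hom_component)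
  then show ?thesis using that hom_component_vec_AR[OF \<rho>(1)] by blast
qed

text \<open>A syzygy with nonzero image under v' witnesses that \<rho>1, \<rho>2, \<rho> have a
  nonzero maximal minor. Replacing \<rho>1 by \<open>a *s \<rho>1\<close>, a multiple of \<rho>2,
  makes that minor vanish, so \<open>a\<close> is zero; similarly for \<open>b\<close>.\<close>

lemma syz_independent:
  assumes \<rho>: "\<rho> \<in> AR f" "bmap \<rho> \<noteq> 0" and rel: "a *s \<rho>1 + b *s \<rho>2 = 0"
  shows "a = 0" "b = 0"
proof -
  obtain k where "pderiv4 k f \<noteq> 0" using exists_pderiv4_nonzero[OF f_facts(1-3)] .
  then have nz: "triple \<rho>1 \<rho>2 \<rho> k \<noteq> 0" using \<rho> by (simp add: triple_eq_bmap)
  have "a *s \<rho>1 = (- b) *s \<rho>2" using rel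
    by (simp add: vec_eq_iff eq_neg_iff_add_eq_0)
  then have "a * triple \<rho>1 \<rho>2 \<rho> k = 0"
    by (metis triple_smult1 triple_equal(3) mult_zero_right)
  then show "a = 0" using nz by simp
  then have "b * triple \<rho>1 \<rho>2 \<rho> k = 0"
    using rel by (metis add_0 triple_smult2 vector_smult_lzero triple_equal(2) triple_smult mult_zero_left)
  then show "b = 0" using nz by simp
qed

end

subsection \<open>Minimal graded resolutions\<close>

lemma irrelevant_ideal_iff: "p \<in> irrelevant_ideal \<longleftrightarrow> hom_component 0 p = 0"
proof
  assume "p \<in> irrelevant_ideal"
  then show "hom_component 0 p = 0"
    by (intro poly_mapping_eqI) (simp add: irrelevant_ideal_def lookup_hom_component mdeg_eq_0_iff)
next
  assume "hom_component 0 p = 0"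
  then show "p \<in> irrelevant_ideal"
    using lookup_hom_component[of 0 p 0] by (simp add: irrelevant_ideal_def)
qed

lemma forms_irrelevant_ideal: "p \<in> forms q \<Longrightarrow> q > 0 \<Longrightarrow> p \<in> irrelevant_ideal"
  by (simp add: irrelevant_ideal_iff hom_component_form)

lemma const_irrelevant_ideal: "const c \<in> irrelevant_ideal \<longleftrightarrow> c = 0"
  by (simp add: irrelevant_ideal_iff hom_component_form[OF const_in_forms])

lemma matrix_of_columns_mult:
  fixes g :: "4 \<Rightarrow> mpoly4 ^ 4"
  shows "(\<chi> i j. g j $ i) *v u = u $ 0 *s g 0 + (u $ 1 *s g 1 + (u $ 2 *s g 2 + u $ 3 *s g 3))"
  by (simp add: vec_eq_iff matrix_vector_mult_def sum_UNIV_4 mult.commute)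

text \<open>The columns of R are the generators and C is the single relation. Minimality comes from
  degrees alone: the entries of G, R and C have degrees d-1, d_j and d_3+1-d_j, all positive.
  Injectivity of C needs just one nonzero entry, here \<open>c 3\<close>.\<close>

lemma nearly_freeI:
  fixes g :: "4 \<Rightarrow> mpoly4 ^ 4" and c :: "4 \<Rightarrow> mpoly4"
  assumes f: "f \<in> forms d" "d \<ge> 2" and e: "1 \<le> d1" "d1 \<le> d2" "d2 \<le> d3"
    and g: "g 0 \<in> AR_deg f d1" "g 1 \<in> AR_deg f d2" "g 2 \<in> AR_deg f d3" "g 3 \<in> AR_deg f d3"
    and gen: "\<And>\<rho>. \<rho> \<in> AR f \<Longrightarrow> \<exists>u :: 4 \<Rightarrow> mpoly4. \<rho> = u 0 *s g 0 + (u 1 *s g 1 + (u 2 *s g 2 + u 3 *s g 3))"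
    and c: "c 0 \<in> forms (d3 + 1 - d1)" "c 1 \<in> forms (d3 + 1 - d2)" "c 2 \<in> forms 1" "c 3 \<in> forms 1"
    and rel: "\<And>u :: 4 \<Rightarrow> mpoly4. u 0 *s g 0 + (u 1 *s g 1 + (u 2 *s g 2 + u 3 *s g 3)) = 0 \<longleftrightarrow> (\<exists>t. \<forall>i. u i = t * c i)"
    and c3: "c 3 \<noteq> 0"
  shows "nearly_free d f d1 d2 d3"
proof -
  define G :: "mpoly4 ^ 4 ^ 1" where "G = (\<chi> i. gradient f)"
  define R :: "mpoly4 ^ 4 ^ 4" where "R = (\<chi> i j. g j $ i)"
  define C :: "mpoly4 ^ 1 ^ 4" where "C = (\<chi> i j. c i)"
  have R: "R *v u = u $ 0 *s g 0 + (u $ 1 *s g 1 + (u $ 2 *s g 2 + u $ 3 *s g 3))" for u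
    unfolding R_def by (rule matrix_of_columns_mult)
  have C: "(C *v u) $ i = u $ 1 * c i" for u i
    by (simp add: C_def matrix_vector_mult_def mult.commute)
  have G: "(G *v u) $ i = (\<Sum>j\<in>UNIV. u $ j * pderiv4 j f)" for u i
    by (simp add: G_def matrix_vector_mult_def gradient_def mult.commute)
  have df: "pderiv4 i f \<in> forms (d - 1)" for i
    using f by (intro pderiv4_in_forms) simp
  have minG: "minimal_graded_matrix (\<lambda>_. int d - 1) (\<lambda>_. 0) G"
  proof -
    have "nat (int d - 1) = d - 1" by simp
    then show ?thesis
      using f(2) df forms_irrelevant_ideal[OF df]
      by (simp add: minimal_graded_matrix_def G_def gradient_def)
  qed
  let ?e = "\<lambda>j::4. if j = 0 then d1 else if j = 1 then d2 else d3"
  have g_forms: "g j $ i \<in> forms (?e j)" for i j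
  proof -
    have "\<forall>j. g j $ i \<in> forms (?e j)"
      unfolding all_4_from_0 using g by (simp add: AR_deg_def)
    then show ?thesis ..
  qed
  have minR: "minimal_graded_matrix (\<lambda>j. int d + int (?e j) - 1) (\<lambda>_. int d - 1) R"
  proof -
    have "nat (int d + int (?e j) - 1 - (int d - 1)) = ?e j" "int d - 1 \<le> int d + int (?e j) - 1" "?e j > 0" for j
      using e by auto
    then show ?thesis
      unfolding minimal_graded_matrix_def R_def vec_lambda_beta
      using g_forms forms_irrelevant_ideal[OF g_forms] by presburger
  qed
  have c_forms: "c i \<in> forms (d3 + 1 - ?e i)" for i
  proof -
    have "\<forall>i. c i \<in> forms (d3 + 1 - ?e i)"
      unfolding all_4_from_0 using c by simp
    then show ?thesis ..
  qed
  have minC: "minimal_graded_matrix (\<lambda>_. int d + int d3) (\<lambda>j. int d + int (?e j) - 1) C"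
  proof -
    have "nat (int d + int d3 - (int d + int (?e j) - 1)) = d3 + 1 - ?e j"
      "int d + int (?e j) - 1 \<le> int d + int d3" "d3 + 1 - ?e j > 0" for j
      using e by auto
    then show ?thesis
      unfolding minimal_graded_matrix_def C_def vec_lambda_beta
      using c_forms forms_irrelevant_ideal[OF c_forms] by presburger
  qed
  have rangeG: "range (\<lambda>u. (G *v u) $ 1) = jacobian_ideal f"
  proof
    show "range (\<lambda>u. (G *v u) $ 1) \<subseteq> jacobian_ideal f"
      unfolding G jacobian_ideal_def
      by clarify (intro ideals.span_sum ideals.span_scale ideals.span_base rangeI)
    show "jacobian_ideal f \<subseteq> range (\<lambda>u. (G *v u) $ 1)"
      unfolding jacobian_ideal_def
    proof (rule ideals.span_minimal)
      show "range (\<lambda>i. pderiv4 i f) \<subseteq> range (\<lambda>u. (G *v u) $ 1)"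
      proof (rule image_subsetI)
        fix i
        have "(\<Sum>j\<in>UNIV. axis i 1 $ j * pderiv4 j f) = (\<Sum>j\<in>UNIV. if j = i then pderiv4 i f else 0)"
          by (intro sum.cong refl) (simp add: axis_def)
        then have "pderiv4 i f = (G *v axis i 1) $ 1" unfolding G by simp
        then show "pderiv4 i f \<in> range (\<lambda>u. (G *v u) $ 1)" by (rule range_eqI)
      qed
      show "ideals.subspace (range (\<lambda>u. (G *v u) $ 1))"
      proof (rule ideals.subspaceI)
        show "0 \<in> range (\<lambda>u. (G *v u) $ 1)"
          by (rule range_eqI[of _ _ 0]) simp
        fix p q assume "p \<in> range (\<lambda>u. (G *v u) $ 1)" "q \<in> range (\<lambda>u. (G *v u) $ 1)"
        then obtain u w where "p = (G *v u) $ 1" "q = (G *v w) $ 1" by blast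
        then have "p + q = (G *v (u + w)) $ 1" by (simp add: matrix_vector_right_distrib)
        then show "p + q \<in> range (\<lambda>u. (G *v u) $ 1)" by (rule range_eqI)
      next
        fix s p assume "p \<in> range (\<lambda>u. (G *v u) $ 1)"
        then obtain u where "p = (G *v u) $ 1" by blast
        then have "s * p = (G *v (s *s u)) $ 1"
          by (simp only: G vector_smult_component sum_distrib_left mult.assoc)
        then show "s * p \<in> range (\<lambda>u. (G *v u) $ 1)" by (rule range_eqI)
      qed
    qed
  qed
  have kerG: "G *v u = 0 \<longleftrightarrow> u \<in> AR f" for u
    unfolding vec_eq_iff G in_AR_iff by simp
  have g_AR: "g j \<in> AR f" for j
  proof -
    have "\<forall>j. g j \<in> AR f" unfolding all_4_from_0 using g by (simp add: AR_deg_def)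
    then show ?thesis ..
  qed
  have exG: "{u. G *v u = 0} = range ((*v) R)"
  proof (intro equalityI subsetI)
    fix \<rho> assume "\<rho> \<in> {u. G *v u = 0}"
    then have "\<rho> \<in> AR f" by (simp only: mem_Collect_eq kerG)
    from gen[OF this] obtain u :: "4 \<Rightarrow> mpoly4" where "\<rho> = u 0 *s g 0 + (u 1 *s g 1 + (u 2 *s g 2 + u 3 *s g 3))"
      by (rule exE)
    then have "\<rho> = R *v (\<chi> i. u i)" unfolding R by simp
    then show "\<rho> \<in> range ((*v) R)" by (rule range_eqI)
  next
    fix \<rho> assume "\<rho> \<in> range ((*v) R)"
    then obtain u where "\<rho> = R *v u" by blast
    then show "\<rho> \<in> {u. G *v u = 0}"
      using g_AR by (simp add: kerG R AR_add AR_smult)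
  qed
  have exR: "{u. R *v u = 0} = range ((*v) C)"
  proof (intro equalityI subsetI)
    fix u assume "u \<in> {u. R *v u = 0}"
    then obtain t where t: "\<forall>i. u $ i = t * c i"
      using rel[of "\<lambda>i. u $ i"] unfolding R by blast
    then have "u = C *v (\<chi> i. t)" by (simp add: vec_eq_iff C)
    then show "u \<in> range ((*v) C)" by (rule range_eqI)
  next
    fix u assume "u \<in> range ((*v) C)"
    then obtain w where w: "u = C *v w" by blast
    then have "\<exists>t. \<forall>i. u $ i = t * c i" by (auto simp: C)
    then show "u \<in> {u. R *v u = 0}"
      using rel[of "\<lambda>i. u $ i"] by (simp add: R)
  qed
  have injC: "inj ((*v) C)"
  proof (rule injI)
    fix u w assume "C *v u = C *v w"
    then have "u $ 1 * c 3 = w $ 1 * c 3" by (metis C)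
    then have "u $ 1 = w $ 1" using c3 by simp
    then show "u = w" by (simp add: vec_eq_iff forall_1)
  qed
  show ?thesis
    unfolding nearly_free_def
    using e G_def minG minR minC rangeG exG exR injC by blast
qed

text \<open>Every relation is a multiple of the single column of C, whose entries have positive
  degree d_3+1-d_j; hence no coefficient of a relation has a constant term. This is the minimality
  used below.\<close>

lemma nearly_freeE:
  assumes "nearly_free d f d1 d2 d3"
  obtains g :: "4 \<Rightarrow> mpoly4 ^ 4"
  where "g 0 \<in> AR_deg f d1" "g 1 \<in> AR_deg f d2" "g 2 \<in> AR_deg f d3" "g 3 \<in> AR_deg f d3"
    and "\<And>\<rho>. \<rho> \<in> AR f \<Longrightarrow> \<exists>u :: 4 \<Rightarrow> mpoly4. \<rho> = u 0 *s g 0 + (u 1 *s g 1 + (u 2 *s g 2 + u 3 *s g 3))"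
    and "\<And>(u :: 4 \<Rightarrow> mpoly4) i. u 0 *s g 0 + (u 1 *s g 1 + (u 2 *s g 2 + u 3 *s g 3)) = 0 \<Longrightarrow> u i \<in> irrelevant_ideal"
proof -
  let ?e = "\<lambda>j::4. if j = 0 then d1 else if j = 1 then d2 else d3"
  obtain G :: "mpoly4 ^ 4 ^ 1" and R :: "mpoly4 ^ 4 ^ 4" and C :: "mpoly4 ^ 1 ^ 4" where
    e: "d1 \<le> d2" "d2 \<le> d3" and G_def: "G = (\<chi> i. gradient f)"
    and minR: "minimal_graded_matrix (\<lambda>j. int d + int (?e j) - 1) (\<lambda>_. int d - 1) R"
    and minC: "minimal_graded_matrix (\<lambda>_. int d + int d3) (\<lambda>j. int d + int (?e j) - 1) C"
    and exG: "{u. G *v u = 0} = range ((*v) R)" and exR: "{u. R *v u = 0} = range ((*v) C)"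
    using assms unfolding nearly_free_def by blast
  define g where "g j = (\<chi> i. R $ i $ j)" for j
  have R_g: "R = (\<chi> i j. g j $ i)" by (simp add: g_def vec_eq_iff)
  have R: "R *v u = u $ 0 *s g 0 + (u $ 1 *s g 1 + (u $ 2 *s g 2 + u $ 3 *s g 3))" for u
    unfolding R_g by (rule matrix_of_columns_mult)
  have kerG: "G *v u = 0 \<longleftrightarrow> u \<in> AR f" for u
    by (simp add: G_def vec_eq_iff matrix_vector_mult_def gradient_def in_AR_iff mult.commute)
  have g_deg: "g j \<in> AR_deg f (?e j)" for j
  proof -
    \<comment> \<open>A column of R is the image of a unit vector, hence a syzygy by
      exactness.\<close>
    have "(\<Sum>k\<in>UNIV. R $ i $ k * axis j 1 $ k) = (\<Sum>k\<in>UNIV. if k = j then R $ i $ j else 0)" for i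
      by (intro sum.cong refl) (simp add: axis_def)
    then have "g j = R *v axis j 1"
      by (simp add: g_def vec_eq_iff matrix_vector_mult_def)
    then have "g j \<in> {u. G *v u = 0}" unfolding exG by (rule range_eqI)
    then have "g j \<in> AR f" by (simp only: mem_Collect_eq kerG)
    moreover have "R $ i $ j \<in> forms (nat (int d + int (?e j) - 1 - (int d - 1)))" for i
    proof -
      have "int d - 1 \<le> int d + int (?e j) - 1" by simp
      then show ?thesis using minR unfolding minimal_graded_matrix_def by meson
    qed
    moreover have "nat (int d + int (?e j) - 1 - (int d - 1)) = ?e j" by simp
    ultimately show ?thesis by (simp add: AR_deg_def g_def)
  qed
  have gen: "\<exists>u :: 4 \<Rightarrow> mpoly4. \<rho> = u 0 *s g 0 + (u 1 *s g 1 + (u 2 *s g 2 + u 3 *s g 3))" if "\<rho> \<in> AR f" for \<rho>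
  proof -
    have "\<rho> \<in> range ((*v) R)"
      unfolding exG[symmetric] using that by (simp only: mem_Collect_eq kerG)
    then obtain u where "\<rho> = R *v u" by (rule rangeE)
    then show ?thesis unfolding R by (intro exI[of _ "\<lambda>i. u $ i"])
  qed
  have irr: "u i \<in> irrelevant_ideal"
    if "u 0 *s g 0 + (u 1 *s g 1 + (u 2 *s g 2 + u 3 *s g 3)) = 0" for u :: "4 \<Rightarrow> mpoly4" and i
  proof -
    have "R *v (\<chi> i. u i) = 0" unfolding R using that by simp
    then have "(\<chi> i. u i) \<in> range ((*v) C)" unfolding exR[symmetric] by (rule CollectI)
    then obtain w where w: "(\<chi> i. u i) = C *v w" by (rule rangeE)
    have "u i = w $ 1 * C $ i $ 1"
      using arg_cong[OF w, of "\<lambda>v. v $ i"] by (simp add: matrix_vector_mult_def mult.commute)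
    moreover have "C $ i $ 1 \<in> forms (d3 + 1 - ?e i)"
    proof -
      have le: "int d + int (?e i) - 1 \<le> int d + int d3" using e by simp
      then have "C $ i $ 1 \<in> forms (nat (int d + int d3 - (int d + int (?e i) - 1)))"
        using minC unfolding minimal_graded_matrix_def by meson
      moreover have "nat (int d + int d3 - (int d + int (?e i) - 1)) = d3 + 1 - ?e i"
        using e by simp
      ultimately show ?thesis by simp
    qed
    moreover have "d3 + 1 - ?e i > 0" using e by simp
    ultimately show ?thesis
      unfolding irrelevant_ideal_iff by (simp add: hom_component_mult_form)
  qed
  show ?thesis
    using that[of g] g_deg[of 0] g_deg[of 1] g_deg[of 2] g_deg[of 3] gen irr by simp
qed

subsection \<open>Linear forms in the Bourbaki ideal\<close>

context tame_surface
begin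

text \<open>
  Let $\tau_1,\tau_2$ be preimages of the basis $l_1,l_2$ of $B(f)_1$ and
  $l_2\tau_1-l_1\tau_2=a\rho_1+b\rho_2$. For every $h\in B(f)$ the products $ha$ and $hb$ lie in the prime
  ideal $(l_1,l_2)$; if $a$ and $b$ both did, then $l_1$ would divide a correction of $\tau_1$ by
  $S\rho_1+S\rho_2$, and the quotient would be a syzygy with image $1$ in $B(f)$.
\<close>

lemma bmap_in_pair_ideal:
  assumes pair: "linear_pair l1 l2" and \<tau>: "\<tau>1 \<in> AR f" "\<tau>2 \<in> AR f" "bmap \<tau>1 = l1" "bmap \<tau>2 = l2"
    and proper: "1 \<notin> bmap ` AR f"
    and rel: "l2 *s \<tau>1 - l1 *s \<tau>2 = a *s \<rho>1 + b *s \<rho>2"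
    and \<rho>: "\<rho> \<in> AR f"
  shows "bmap \<rho> \<in> pair_ideal l1 l2"
proof (rule ccontr)
  note nz = linear_pair_nonzero[OF pair]
  have forms: "l1 \<in> forms 1" "l2 \<in> forms 1"
    using pair by (simp_all add: linear_pair_def)
  define h where "h = bmap \<rho>"
  assume "\<not> ?thesis"
  then have h: "h \<notin> pair_ideal l1 l2" by (simp add: h_def)
  have "bmap (l1 *s \<rho> - h *s \<tau>1) = 0" "bmap (l2 *s \<rho> - h *s \<tau>2) = 0"
    using \<rho> \<tau> by (simp_all add: bmap_diff bmap_smult AR_smult h_def mult.commute)
  moreover have "l1 *s \<rho> - h *s \<tau>1 \<in> AR f" "l2 *s \<rho> - h *s \<tau>2 \<in> AR f"
    using \<rho> \<tau> by (simp_all add: AR_diff AR_smult)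
  ultimately obtain a' b' a'' b''
    where 1: "l1 *s \<rho> - h *s \<tau>1 = a' *s \<rho>1 + b' *s \<rho>2" and 2: "l2 *s \<rho> - h *s \<tau>2 = a'' *s \<rho>1 + b'' *s \<rho>2"
    by (metis bmap_eq_0)
  \<comment> \<open>\<open>l2\<close> times the first relation minus \<open>l1\<close> times the
    second plus \<open>h\<close> times \<open>rel\<close>: the terms in \<rho>, \<tau>1 and \<tau>2
    cancel.\<close>
  have "(h * a + l2 * a' - l1 * a'') *s \<rho>1 + (h * b + l2 * b' - l1 * b'') *s \<rho>2 = 0"
    unfolding vec_eq_iff
  proof
    fix i
    have "l2 * \<tau>1 $ i - l1 * \<tau>2 $ i = a * \<rho>1 $ i + b * \<rho>2 $ i"
      "l1 * \<rho> $ i - h * \<tau>1 $ i = a' * \<rho>1 $ i + b' * \<rho>2 $ i"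
      "l2 * \<rho> $ i - h * \<tau>2 $ i = a'' * \<rho>1 $ i + b'' * \<rho>2 $ i"
      using rel 1 2 unfolding vec_eq_iff by simp_all
    then have "(h * a + l2 * a' - l1 * a'') * \<rho>1 $ i + (h * b + l2 * b' - l1 * b'') * \<rho>2 $ i = 0"
      by algebra
    then show "((h * a + l2 * a' - l1 * a'') *s \<rho>1 + (h * b + l2 * b' - l1 * b'') *s \<rho>2) $ i = 0 $ i"
      by (simp only: vector_add_component vector_smult_component zero_index)
  qed
  note zero = syz_independent[OF \<tau>(1) _ this, unfolded \<tau>(3), OF nz(1)]
  have "h * a = a'' * l1 + (- a') * l2" using zero(1) by algebra
  then have "h * a \<in> pair_ideal l1 l2" unfolding pair_ideal_def by blast
  then have "a \<in> pair_ideal l1 l2" using linear_pair_prime[OF pair] h by blast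
  then obtain a1 a2 where a: "a = a1 * l1 + a2 * l2" unfolding pair_ideal_def by blast
  have "h * b = b'' * l1 + (- b') * l2" using zero(2) by algebra
  then have "h * b \<in> pair_ideal l1 l2" unfolding pair_ideal_def by blast
  then have "b \<in> pair_ideal l1 l2" using linear_pair_prime[OF pair] h by blast
  then obtain b1 b2 where b: "b = b1 * l1 + b2 * l2" unfolding pair_ideal_def by blast
  have "\<exists>t. \<tau>1 $ i - a2 * \<rho>1 $ i - b2 * \<rho>2 $ i = t * l1" for i
  proof -
    have "l2 * \<tau>1 $ i - l1 * \<tau>2 $ i = a * \<rho>1 $ i + b * \<rho>2 $ i"
      using rel unfolding vec_eq_iff by simp
    \<comment> \<open>Inserting the expressions for \<open>a\<close> and \<open>b\<close> and
      sorting by \<open>l1\<close> and \<open>l2\<close> gives a Koszul relation in each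
      coordinate.\<close>
    then have "(\<tau>2 $ i + a1 * \<rho>1 $ i + b1 * \<rho>2 $ i) * l1 = (\<tau>1 $ i - a2 * \<rho>1 $ i - b2 * \<rho>2 $ i) * l2"
      unfolding a b by algebra
    then show ?thesis using linear_pair_koszul[OF pair] by blast
  qed
  then obtain t where t: "\<And>i. \<tau>1 $ i - a2 * \<rho>1 $ i - b2 * \<rho>2 $ i = t i * l1" by metis
  define \<sigma> where "\<sigma> = (\<chi> i. t i)"
  have \<sigma>: "l1 *s \<sigma> = \<tau>1 - (a2 *s \<rho>1 + b2 *s \<rho>2)"
    unfolding vec_eq_iff
  proof
    fix i
    show "(l1 *s \<sigma>) $ i = (\<tau>1 - (a2 *s \<rho>1 + b2 *s \<rho>2)) $ i"
      using t[of i] by (simp add: \<sigma>_def mult.commute diff_diff_eq)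
  qed
  have AR': "a2 *s \<rho>1 + b2 *s \<rho>2 \<in> AR f" using syz_AR by (simp add: AR_add AR_smult)
  have "l1 *s \<sigma> \<in> AR f" unfolding \<sigma> by (intro AR_diff \<tau>(1) AR')
  then have "l1 * (\<Sum>i\<in>UNIV. \<sigma> $ i * pderiv4 i f) = 0"
    by (simp only: in_AR_iff vector_smult_component mult.assoc sum_distrib_left)
  then have \<sigma>_AR: "\<sigma> \<in> AR f" using nz(1) by (simp add: in_AR_iff)
  \<comment> \<open>The correction lies in the kernel of v', so \<open>l1 *s \<sigma>\<close> has
    the same image \<open>l1\<close> as \<tau>1.\<close>
  have "l1 * bmap \<sigma> = l1 * 1"
    using \<tau> AR' by (simp add: \<sigma> bmap_diff bmap_syz flip: bmap_smult[OF \<sigma>_AR])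
  then have "bmap \<sigma> = 1" by (simp only: mult_left_cancel[OF nz(1)])
  then show False using proper \<sigma>_AR by (metis image_eqI)
qed

lemma dim_imp_nearly_free:
  assumes e: "1 \<le> e1" "e1 \<le> e2" "e2 \<le> e3"
    and dim: "cpoly.dim (bourbaki_ideal f \<rho>1 \<rho>2 \<inter> forms 1) = 2"
  shows "nearly_free d f e1 e2 (e3 + 1)"
proof -
  let ?B = "bourbaki_ideal f \<rho>1 \<rho>2"
  obtain l1 l2 where pair: "linear_pair l1 l2" and l: "l1 \<in> ?B" "l2 \<in> ?B" "l1 \<in> forms 1" "l2 \<in> forms 1"
    and B1: "?B \<inter> forms 1 \<subseteq> pair_ideal l1 l2"
    using dim_eq_2_imp_linear_pair[OF _ dim] by (metis Int_iff inf_le2)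
  note nz = linear_pair_nonzero[OF pair]
  obtain \<tau>1 where \<tau>1: "\<tau>1 \<in> AR_deg f (1 + e3)" "bmap \<tau>1 = l1"
    using bourbaki_ideal_linear_preimage l by metis
  obtain \<tau>2 where \<tau>2: "\<tau>2 \<in> AR_deg f (1 + e3)" "bmap \<tau>2 = l2"
    using bourbaki_ideal_linear_preimage l by metis
  have \<tau>_AR: "\<tau>1 \<in> AR f" "\<tau>2 \<in> AR f" and \<tau>_forms: "\<tau>1 $ i \<in> forms (1 + e3)" "\<tau>2 $ i \<in> forms (1 + e3)" for i
    using \<tau>1 \<tau>2 by (simp_all add: AR_deg_def)
  \<comment> \<open>If 1 were in B(f), all four variables would lie in B(f)_1 and thus in
    (l_1,l_2).\<close>
  have proper: "1 \<notin> bmap ` AR f"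
  proof
    assume "1 \<in> bmap ` AR f"
    then obtain \<sigma> where \<sigma>: "\<sigma> \<in> AR f" "bmap \<sigma> = 1" by (metis imageE)
    obtain k where k: "var k \<notin> pair_ideal l1 l2" using linear_pair_not_all_vars[OF pair] .
    have "bmap (var k *s \<sigma>) = var k" using \<sigma> by (simp add: bmap_smult)
    then have "var k \<in> ?B"
      unfolding bourbaki_ideal_def using AR_smult[OF \<sigma>(1)] by (metis image_eqI)
    then show False using B1 k var_in_forms by blast
  qed
  have "bmap (l2 *s \<tau>1 - l1 *s \<tau>2) = 0"
    using \<tau>_AR \<tau>1 \<tau>2 by (simp add: bmap_diff bmap_smult AR_smult mult.commute)
  then obtain a0 b0 where rel0: "l2 *s \<tau>1 - l1 *s \<tau>2 = a0 *s \<rho>1 + b0 *s \<rho>2"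
    using \<tau>_AR bmap_eq_0 by (metis AR_diff AR_smult)
  \<comment> \<open>Tameness gives coefficients that need not be homogeneous. Both sides have degree
    \<open>e3 + 2\<close>, one for the linear form and \<open>e3 + 1\<close> for \<tau>1 or \<tau>2,
    so the matching components suffice.\<close>
  define a where "a = hom_component (e3 + 2 - e1) a0"
  define b where "b = hom_component (e3 + 2 - e2) b0"
  have rel: "l2 *s \<tau>1 - l1 *s \<tau>2 = a *s \<rho>1 + b *s \<rho>2"
  proof -
    have "(l2 *s \<tau>1 - l1 *s \<tau>2) $ i \<in> forms (e3 + 2)" for i
      using forms_diff[OF forms_mult[OF l(4) \<tau>_forms(1)[of i]] forms_mult[OF l(3) \<tau>_forms(2)[of i]]]
      by simp
    then have "l2 *s \<tau>1 - l1 *s \<tau>2 = hom_component_vec (e3 + 2) (l2 *s \<tau>1 - l1 *s \<tau>2)"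
      by (rule hom_component_vec_form[symmetric])
    also have "\<dots> = a *s \<rho>1 + b *s \<rho>2"
      using e unfolding rel0 a_def b_def
      by (simp add: hom_component_vec_add hom_component_vec_smult[OF syz_forms(1)]
          hom_component_vec_smult[OF syz_forms(2)])
    finally show ?thesis .
  qed
  define g where "g j = (if j = 0 then \<rho>1 else if j = 1 then \<rho>2 else if j = 2 then \<tau>1 else \<tau>2)" for j :: 4
  have g: "g 0 = \<rho>1" "g 1 = \<rho>2" "g 2 = \<tau>1" "g 3 = \<tau>2" by (simp_all add: g_def)
  \<comment> \<open>The coefficients of \<open>rel\<close> with all terms moved to one side.\<close>
  define c where "c j = (if j = 0 then a else if j = 1 then b else if j = 2 then - l2 else l1)" for j :: 4
  have c: "c 0 = a" "c 1 = b" "c 2 = - l2" "c 3 = l1" by (simp_all add: c_def)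
  have gen: "\<exists>u :: 4 \<Rightarrow> mpoly4. \<rho> = u 0 *s g 0 + (u 1 *s g 1 + (u 2 *s g 2 + u 3 *s g 3))"
    if \<rho>: "\<rho> \<in> AR f" for \<rho>
  proof -
    obtain s t where st: "bmap \<rho> = s * l1 + t * l2"
      using bmap_in_pair_ideal[OF pair \<tau>_AR \<tau>1(2) \<tau>2(2) proper rel \<rho>] unfolding pair_ideal_def by blast
    have "bmap (\<rho> - (s *s \<tau>1 + t *s \<tau>2)) = 0"
      using \<rho> \<tau>_AR by (simp add: bmap_diff bmap_add bmap_smult AR_add AR_smult st \<tau>1 \<tau>2)
    moreover have "\<rho> - (s *s \<tau>1 + t *s \<tau>2) \<in> AR f"
      using \<rho> \<tau>_AR by (simp add: AR_diff AR_add AR_smult)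
    ultimately obtain x y where xy: "\<rho> - (s *s \<tau>1 + t *s \<tau>2) = x *s \<rho>1 + y *s \<rho>2"
      by (metis bmap_eq_0)
    define u where "u j = (if j = 0 then x else if j = 1 then y else if j = 2 then s else t)" for j :: 4
    have "u 0 = x" "u 1 = y" "u 2 = s" "u 3 = t" by (simp_all add: u_def)
    then have "\<rho> = u 0 *s g 0 + (u 1 *s g 1 + (u 2 *s g 2 + u 3 *s g 3))"
      using xy by (simp only: g diff_eq_eq add.assoc)
    then show ?thesis by (rule exI[of _ u])
  qed
  have rels: "u 0 *s g 0 + (u 1 *s g 1 + (u 2 *s g 2 + u 3 *s g 3)) = 0 \<longleftrightarrow> (\<exists>t. \<forall>i. u i = t * c i)"
    for u :: "4 \<Rightarrow> mpoly4"
  proof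
    assume z: "u 0 *s g 0 + (u 1 *s g 1 + (u 2 *s g 2 + u 3 *s g 3)) = 0"
    \<comment> \<open>v' kills the part in \<rho>1 and \<rho>2. What remains is a relation between
      \<open>l1\<close> and \<open>l2\<close>, which is a Koszul relation; independence of \<rho>1
      and \<rho>2 then fixes \<open>u 0\<close> and \<open>u 1\<close>.\<close>
    have "bmap (u 0 *s g 0 + (u 1 *s g 1 + (u 2 *s g 2 + u 3 *s g 3))) = u 2 * l1 + u 3 * l2"
      unfolding g add.assoc[symmetric] using \<tau>_AR syz_AR
      by (simp add: bmap_add AR_add AR_smult bmap_smult \<tau>1 \<tau>2 bmap_syz)
    then have "u 2 * l1 + u 3 * l2 = 0"
      unfolding z using bmap_syz[of 0 0] by simp
    then have "u 2 * l1 = (- u 3) * l2" by (simp add: add_eq_0_iff2)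
    then obtain s where s: "u 2 = s * l2" "- u 3 = s * l1"
      using linear_pair_koszul[OF pair] by blast
    have "(u 0 + s * a) *s \<rho>1 + (u 1 + s * b) *s \<rho>2 = 0"
      unfolding vec_eq_iff
    proof
      fix i
      have "u 0 * \<rho>1 $ i + (u 1 * \<rho>2 $ i + (u 2 * \<tau>1 $ i + u 3 * \<tau>2 $ i)) = 0"
        using z unfolding g vec_eq_iff by simp
      moreover have "l2 * \<tau>1 $ i - l1 * \<tau>2 $ i = a * \<rho>1 $ i + b * \<rho>2 $ i"
        using rel unfolding vec_eq_iff by simp
      ultimately have "(u 0 + s * a) * \<rho>1 $ i + (u 1 + s * b) * \<rho>2 $ i = 0"
        using s by algebra
      then show "((u 0 + s * a) *s \<rho>1 + (u 1 + s * b) *s \<rho>2) $ i = 0 $ i"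
        by (simp only: vector_add_component vector_smult_component zero_index)
    qed
    note zero = syz_independent[OF \<tau>_AR(1) _ this, unfolded \<tau>1(2), OF nz(1)]
    \<comment> \<open>The factor is \<open>- s\<close> because \<open>c 2\<close> is
      \<open>- l2\<close> whereas \<open>u 2 = s * l2\<close>.\<close>
    have "\<forall>i. u i = (- s) * c i"
      unfolding all_4_from_0 c
      using zero s by (intro conjI; algebra)
    then show "\<exists>t. \<forall>i. u i = t * c i" by (rule exI[of _ "- s"])
  next
    assume "\<exists>t. \<forall>i. u i = t * c i"
    then obtain t where t: "u 0 = t * a" "u 1 = t * b" "u 2 = t * - l2" "u 3 = t * l1"
      by (metis c)
    show "u 0 *s g 0 + (u 1 *s g 1 + (u 2 *s g 2 + u 3 *s g 3)) = 0"
      unfolding g vec_eq_iff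
    proof
      fix i
      have "l2 * \<tau>1 $ i - l1 * \<tau>2 $ i = a * \<rho>1 $ i + b * \<rho>2 $ i"
        using rel unfolding vec_eq_iff by simp
      then have "u 0 * \<rho>1 $ i + (u 1 * \<rho>2 $ i + (u 2 * \<tau>1 $ i + u 3 * \<tau>2 $ i)) = 0"
        unfolding t by algebra
      then show "(u 0 *s \<rho>1 + (u 1 *s \<rho>2 + (u 2 *s \<tau>1 + u 3 *s \<tau>2))) $ i = 0 $ i"
        by (simp only: vector_add_component vector_smult_component zero_index)
    qed
  qed
  have c_forms: "a \<in> forms (e3 + 1 + 1 - e1)" "b \<in> forms (e3 + 1 + 1 - e2)"
    using hom_component_in_forms[of "e3 + 2 - e1" a0] hom_component_in_forms[of "e3 + 2 - e2" b0]
    by (simp_all add: a_def b_def)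
  show ?thesis
  proof (rule nearly_freeI[OF _ _ _ _ _ _ _ _ _ gen _ _ _ _ rels])
    show "f \<in> forms d" by (rule f_facts)
    show "d \<ge> 2" "1 \<le> e1" "e1 \<le> e2" "e2 \<le> e3 + 1" using e d_eq by simp_all
    show "g 0 \<in> AR_deg f e1" "g 1 \<in> AR_deg f e2" "g 2 \<in> AR_deg f (e3 + 1)" "g 3 \<in> AR_deg f (e3 + 1)"
      using syz1 syz2 \<tau>1(1) \<tau>2(1) by (simp_all add: g)
    show "c 0 \<in> forms (e3 + 1 + 1 - e1)" "c 1 \<in> forms (e3 + 1 + 1 - e2)" "c 2 \<in> forms 1" "c 3 \<in> forms 1" "c 3 \<noteq> 0"
      unfolding c using c_forms l nz by (simp_all only: forms_uminus not_False_eq_True)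
  qed assumption
qed

lemma nearly_free_imp_dim:
  assumes e: "e1 \<le> e2" "e2 \<le> e3" and nf: "nearly_free d f e1 e2 (e3 + 1)"
  shows "cpoly.dim (bourbaki_ideal f \<rho>1 \<rho>2 \<inter> forms 1) = 2"
proof -
  obtain g :: "4 \<Rightarrow> mpoly4 ^ 4" where
    g: "g 0 \<in> AR_deg f e1" "g 1 \<in> AR_deg f e2" "g 2 \<in> AR_deg f (e3 + 1)" "g 3 \<in> AR_deg f (e3 + 1)"
    and gen: "\<And>\<rho>. \<rho> \<in> AR f \<Longrightarrow> \<exists>u :: 4 \<Rightarrow> mpoly4. \<rho> = u 0 *s g 0 + (u 1 *s g 1 + (u 2 *s g 2 + u 3 *s g 3))"
    and irr: "\<And>(u :: 4 \<Rightarrow> mpoly4) i. u 0 *s g 0 + (u 1 *s g 1 + (u 2 *s g 2 + u 3 *s g 3)) = 0 \<Longrightarrow>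
      u i \<in> irrelevant_ideal"
    using nearly_freeE[OF nf] by metis
  have g_AR: "g 0 \<in> AR f" "g 1 \<in> AR f" "g 2 \<in> AR f" "g 3 \<in> AR f"
    and g_forms: "g 0 $ i \<in> forms e1" "g 1 $ i \<in> forms e2" "g 2 $ i \<in> forms (e3 + 1)" "g 3 $ i \<in> forms (e3 + 1)" for i
    using g by (simp_all add: AR_deg_def)
  \<comment> \<open>In degrees up to \<open>e3\<close> the homogeneous part of the expansion
    contains no contribution of the generators of degree \<open>e3 + 1\<close>.\<close>
  have low: "\<exists>x y. \<rho> = x *s g 0 + y *s g 1" if \<rho>: "\<rho> \<in> AR_deg f q" and q: "q < e3 + 1" for \<rho> q
  proof -
    have "\<rho> \<in> AR f" using \<rho> by (simp add: AR_deg_def)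
    from gen[OF this] obtain u :: "4 \<Rightarrow> mpoly4"
      where u: "\<rho> = u 0 *s g 0 + (u 1 *s g 1 + (u 2 *s g 2 + u 3 *s g 3))" by (rule exE)
    have "\<rho> = hom_component_vec q \<rho>"
      using \<rho> by (intro hom_component_vec_form[symmetric]) (simp add: AR_deg_def)
    also have "\<dots> = (if e1 \<le> q then hom_component (q - e1) (u 0) else 0) *s g 0 +
        (if e2 \<le> q then hom_component (q - e2) (u 1) else 0) *s g 1"
      using q unfolding u hom_component_vec_add hom_component_vec_smult[OF g_forms(1)]
        hom_component_vec_smult[OF g_forms(2)] hom_component_vec_smult[OF g_forms(3)]
        hom_component_vec_smult[OF g_forms(4)] by simp
    finally show ?thesis by blast
  qed
  obtain x1 y1 where r1: "\<rho>1 = x1 *s g 0 + y1 *s g 1" using low[OF syz1] e by auto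
  obtain x2 y2 where r2: "\<rho>2 = x2 *s g 0 + y2 *s g 1" using low[OF syz2] e by auto
  \<comment> \<open>Here \<rho>1, \<rho>2 and the argument are all combinations of
    \<open>g 0\<close> and \<open>g 1\<close>, so every maximal minor vanishes.\<close>
  have span: "bmap (s *s g 0 + t *s g 1) = 0" for s t
    by (rule bmap_unique) (simp only: r1 r2 triple_rank2 mult_zero_left)
  have bm: "bmap (u0 *s g 0 + (u1 *s g 1 + (u2 *s g 2 + u3 *s g 3))) = u2 * bmap (g 2) + u3 * bmap (g 3)" for u0 u1 u2 u3
    unfolding add.assoc[symmetric] using g_AR by (simp add: bmap_add AR_add AR_smult bmap_smult span)
  have lin: "bmap (g 2) \<in> forms 1" "bmap (g 3) \<in> forms 1"
    using g by (auto intro!: bmap_forms simp: add.commute)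
  have "\<alpha> = 0 \<and> \<beta> = 0" if z: "const \<alpha> * bmap (g 2) + const \<beta> * bmap (g 3) = 0" for \<alpha> \<beta>
  proof -
    have "bmap (const \<alpha> *s g 2 + const \<beta> *s g 3) = 0"
      using bm[of 0 0 "const \<alpha>" "const \<beta>"] z by simp
    moreover have "const \<alpha> *s g 2 + const \<beta> *s g 3 \<in> AR f"
      using g_AR by (simp add: AR_add AR_smult)
    ultimately obtain a b where ab: "const \<alpha> *s g 2 + const \<beta> *s g 3 = a *s \<rho>1 + b *s \<rho>2"
      by (metis bmap_eq_0)
    \<comment> \<open>The equation \<open>ab\<close> with \<rho>1 and \<rho>2 expanded in
      \<open>g 0\<close> and \<open>g 1\<close>. It is a relation of the generators with constant
      coefficients at \<open>g 2\<close> and \<open>g 3\<close>, which minimality forces to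
      vanish.\<close>
    define u where "u j = (if j = 0 then - (a * x1 + b * x2) else if j = 1 then - (a * y1 + b * y2)
      else if j = 2 then const \<alpha> else const \<beta>)" for j :: 4
    have u: "u 0 = - (a * x1 + b * x2)" "u 1 = - (a * y1 + b * y2)" "u 2 = const \<alpha>" "u 3 = const \<beta>"
      by (simp_all add: u_def)
    have "u 0 *s g 0 + (u 1 *s g 1 + (u 2 *s g 2 + u 3 *s g 3)) = 0"
      unfolding vec_eq_iff
    proof
      fix i
      have "const \<alpha> * g 2 $ i + const \<beta> * g 3 $ i =
          a * (x1 * g 0 $ i + y1 * g 1 $ i) + b * (x2 * g 0 $ i + y2 * g 1 $ i)"
        using arg_cong[OF ab, of "\<lambda>v. v $ i"]
        by (simp only: r1 r2 vector_add_component vector_smult_component)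
      then have "u 0 * g 0 $ i + (u 1 * g 1 $ i + (u 2 * g 2 $ i + u 3 * g 3 $ i)) = 0"
        unfolding u by algebra
      then show "(u 0 *s g 0 + (u 1 *s g 1 + (u 2 *s g 2 + u 3 *s g 3))) $ i = 0 $ i"
        by (simp only: vector_add_component vector_smult_component zero_index)
    qed
    then have "u 2 \<in> irrelevant_ideal" "u 3 \<in> irrelevant_ideal" by (rule irr)+
    then show ?thesis by (simp add: u const_irrelevant_ideal)
  qed
  then have pair: "linear_pair (bmap (g 2)) (bmap (g 3))"
    unfolding linear_pair_def using lin by blast
  have "bourbaki_ideal f \<rho>1 \<rho>2 \<inter> forms 1 = {const \<alpha> * bmap (g 2) + const \<beta> * bmap (g 3) | \<alpha> \<beta>. True}"
  proof (intro equalityI subsetI)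
    fix p assume p: "p \<in> bourbaki_ideal f \<rho>1 \<rho>2 \<inter> forms 1"
    then obtain \<rho> where \<rho>: "\<rho> \<in> AR f" "p = bmap \<rho>" unfolding bourbaki_ideal_def by blast
    from gen[OF \<rho>(1)] obtain u :: "4 \<Rightarrow> mpoly4"
      where u: "\<rho> = u 0 *s g 0 + (u 1 *s g 1 + (u 2 *s g 2 + u 3 *s g 3))" by (rule exE)
    have "p = u 2 * bmap (g 2) + u 3 * bmap (g 3)" by (simp only: \<rho>(2) u bm)
    moreover have "p = hom_component 1 p" using p by (simp add: forms_iff_hom_component)
    \<comment> \<open>Both generators of B(f) are linear, so in degree one only the constant terms
      of the coefficients count.\<close>
    ultimately have "p = hom_component 0 (u 2) * bmap (g 2) + hom_component 0 (u 3) * bmap (g 3)"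
      by (simp add: hom_component_add hom_component_mult_form[OF lin(1)] hom_component_mult_form[OF lin(2)])
    then have "p = const (Poly_Mapping.lookup (hom_component 0 (u 2)) 0) * bmap (g 2) +
        const (Poly_Mapping.lookup (hom_component 0 (u 3)) 0) * bmap (g 3)"
      by (simp only: forms_0_const[OF hom_component_in_forms, symmetric])
    then show "p \<in> {const \<alpha> * bmap (g 2) + const \<beta> * bmap (g 3) | \<alpha> \<beta>. True}" by blast
  next
    fix p assume "p \<in> {const \<alpha> * bmap (g 2) + const \<beta> * bmap (g 3) | \<alpha> \<beta>. True}"
    then obtain \<alpha> \<beta> where p: "p = const \<alpha> * bmap (g 2) + const \<beta> * bmap (g 3)" by blast
    have "bmap (const \<alpha> *s g 2 + const \<beta> *s g 3) = p"
      using g_AR by (simp add: p bmap_add bmap_smult AR_smult)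
    moreover have "const \<alpha> *s g 2 + const \<beta> *s g 3 \<in> AR f"
      using g_AR by (simp add: AR_add AR_smult)
    ultimately have "p \<in> bourbaki_ideal f \<rho>1 \<rho>2"
      unfolding bourbaki_ideal_def by (metis image_eqI)
    moreover have "p \<in> forms 1"
      unfolding p by (intro forms_add forms_const_mult lin)
    ultimately show "p \<in> bourbaki_ideal f \<rho>1 \<rho>2 \<inter> forms 1" by blast
  qed
  then show ?thesis by (rule linear_pair_imp_dim_eq_2[OF pair])
qed

end

theorem proposition5p1:
  fixes f :: mpoly4 and d e1 e2 e3 :: nat and \<rho>1 \<rho>2 :: "mpoly4 ^ 4"
  assumes "reduced_surface d f"
    and "\<not> is_cone f"
    and "has_proj_dim (jacobian_ideal f) 1"
    and "minimal_syzygy_pair f \<rho>1 \<rho>2 e1 e2"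
    and "e1 \<le> e2"
    and "tame f \<rho>1 \<rho>2"
    and "int e3 = int d - 1 - int e1 - int e2"
    and "e3 \<ge> e2"
  shows "nearly_free d f e1 e2 (e3 + 1) \<longleftrightarrow>
         cpoly.dim (bourbaki_ideal f \<rho>1 \<rho>2 \<inter> forms 1) = 2"
proof -
  have syz: "\<rho>1 \<in> AR_deg f e1" "\<rho>2 \<in> AR_deg f e2" "\<rho>1 \<noteq> 0"
    using assms(4) by (simp_all add: minimal_syzygy_pair_def)
  interpret tame_surface f d e1 e2 e3 \<rho>1 \<rho>2
    using assms(1,6,7) syz by unfold_locales linarith+
  \<comment> \<open>A syzygy of degree 0 has constant entries and would make the surface a
    cone.\<close>
  have "e1 \<noteq> 0"
  proof
    assume "e1 = 0"
    define c where "c i = Poly_Mapping.lookup (\<rho>1 $ i) 0" for i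
    have c: "\<rho>1 $ i = const (c i)" for i
      unfolding c_def using syz_forms(1) \<open>e1 = 0\<close> by (intro forms_0_const) metis
    obtain k where "\<rho>1 $ k \<noteq> 0" using syz(3) by (auto simp: vec_eq_iff)
    then have "c k \<noteq> 0" by (simp add: c)
    moreover have "(\<Sum>i\<in>UNIV. const (c i) * pderiv4 i f) = 0"
      using syz_AR(1) by (simp only: in_AR_iff c)
    ultimately show False using constant_syzygy_imp_cone assms(2) by metis
  qed
  then show ?thesis
    using dim_imp_nearly_free nearly_free_imp_dim assms(5,8) by (metis One_nat_def Suc_leI neq0_conv)
qed

end
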